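(* Let $W_1, \ldots , W_t$ be infinite, finitely generated subgroups of $\mathbb{Q}^{\times}$, let $k_1, \ldots , k_t$ be positive integers, let $F$ be a finite Galois extension of $\mathbb{Q}$ and let $C$ be a conjugacy class of $\mathrm{Gal}(F/\mathbb{Q})$. With $d_n$ and $d_\infty$ as defined in the context, if $d_n \neq 0$ for all squarefree positive integers $n$, then $d_{\infty} \neq 0$.
   Context: $\ell$ always denotes a prime. For each $i$, $q_i(\ell)$ is the smallest power of $\ell$ not dividing $k_i$. Let $\zeta_m$ be a primitive $m$-th root of unity and $W^{1/m} = \{w^{1/m} : w \in W\}$. Put $L_{\ell} = \mathbb{Q}(\zeta_{\max(q_1(\ell), \ldots , q_t(\ell))}, W_1^{1/q_1(\ell)}, \ldots , W_t^{1/q_t(\ell)})$, and for squarefree $n$ let $L_n$ be the compositum of $L_\ell$, $\ell \mid n$. Let $C_n$ be the set of $\sigma \in \mathrm{Gal}(FL_n/\mathbb{Q})$ with $\sigma|_F \in C$ and such that $\sigma$ is not the identity on $\mathbb{Q}(\zeta_{q_i(\ell)}, W_i^{1/q_i(\ell)})$ for any $1 \le i \le t$ and any $\ell \mid n$. Let $d_n = |C_n|/|\mathrm{Gal}(FL_n/\mathbb{Q})|$. Since $d_n \ge d_m \ge 0$ whenever $n \mid m$, $d_\infty$ is the limit of $d_n$ as $n$ ranges over squarefree positive integers ordered by divisibility. *)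

theory Defs
  imports "HOL-Algebra.Algebra" "HOL-Algebra.Algebraic_Closure_Type" "HOL-Analysis.Analysis"
begin

text \<open>
  All number fields are subfields of the complex numbers, so that composita make sense.
  \<open>CC\<close> is the field of complex numbers in the sense of HOL-Algebra.
\<close>

abbreviation CC :: "complex ring" where
  "CC \<equiv> ring_of_type_algebra"

definition galois_group :: "complex set \<Rightarrow> complex set \<Rightarrow> (complex \<Rightarrow> complex) monoid" where
  "galois_group L K = BijGroup L
     \<lparr>carrier := {\<sigma> \<in> Bij L.
        \<sigma> \<in> ring_hom (CC\<lparr>carrier := L\<rparr>) (CC\<lparr>carrier := L\<rparr>) \<and> (\<forall>x\<in>K. \<sigma> x = x)}\<rparr>"

definition finite_galois_extension :: "complex set \<Rightarrow> complex set \<Rightarrow> bool" where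
  "finite_galois_extension L K \<longleftrightarrow>
     subfield K CC \<and> subfield L CC \<and> K \<subseteq> L \<and> ring.finite_dimension CC K L \<and>
     {x \<in> L. \<forall>\<sigma>\<in>carrier (galois_group L K). \<sigma> x = x} = K"

definition conjugacy_class :: "('a, 'b) monoid_scheme \<Rightarrow> 'a set \<Rightarrow> bool" where
  "conjugacy_class G C \<longleftrightarrow>
     (\<exists>g\<in>carrier G. C = {h \<otimes>\<^bsub>G\<^esub> g \<otimes>\<^bsub>G\<^esub> inv\<^bsub>G\<^esub> h | h. h \<in> carrier G})"

abbreviation QQ_units :: "complex monoid" where
  "QQ_units \<equiv> Multiplicative_Group.mult_of (CC\<lparr>carrier := \<rat>\<rparr>)"

definition finitely_generated_subgroup :: "('a, 'b) monoid_scheme \<Rightarrow> 'a set \<Rightarrow> bool" where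
  "finitely_generated_subgroup G H \<longleftrightarrow>
     subgroup H G \<and> (\<exists>S. finite S \<and> S \<subseteq> carrier G \<and> H = generate G S)"

definition QQ_adjoin :: "complex set \<Rightarrow> complex set" where
  "QQ_adjoin S = generate_field CC (\<rat> \<union> S)"

definition zeta :: "nat \<Rightarrow> complex" where
  "zeta m = cis (2 * pi / real m)"

text \<open>
  All \<open>m\<close>-th roots are taken. The fields below do not depend on this, because \<open>root_set W m\<close>
  is always adjoined together with a primitive root of unity of order divisible by \<open>m\<close>.
\<close>

definition root_set :: "complex set \<Rightarrow> nat \<Rightarrow> complex set" where
  "root_set W m = {z. z ^ m \<in> W}"

definition q_power :: "nat \<Rightarrow> nat \<Rightarrow> nat" where
  "q_power k l = (LEAST m. (\<exists>e. m = l ^ e) \<and> \<not> m dvd k)"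

text \<open>
  The subgroups and the integers are the families \<open>W i\<close> and \<open>k i\<close> with \<open>i \<in> {1..t}\<close>;
  values outside this range are irrelevant. For \<open>t = 0\<close> the maximum in \<open>L_prime\<close> is an
  unspecified number, which has no influence on \<open>dens\<close>: the condition at \<open>l\<close> in
  \<open>C_set\<close> is then void.
\<close>

definition K_field :: "(nat \<Rightarrow> complex set) \<Rightarrow> (nat \<Rightarrow> nat) \<Rightarrow> nat \<Rightarrow> nat \<Rightarrow> complex set" where
  "K_field W k i l = QQ_adjoin ({zeta (q_power (k i) l)} \<union> root_set (W i) (q_power (k i) l))"

definition L_prime ::
  "nat \<Rightarrow> (nat \<Rightarrow> complex set) \<Rightarrow> (nat \<Rightarrow> nat) \<Rightarrow> nat \<Rightarrow> complex set" where
  "L_prime t W k l = QQ_adjoin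
     ({zeta (MAX i\<in>{1..t}. q_power (k i) l)} \<union> (\<Union>i\<in>{1..t}. root_set (W i) (q_power (k i) l)))"

definition L_field ::
  "nat \<Rightarrow> (nat \<Rightarrow> complex set) \<Rightarrow> (nat \<Rightarrow> nat) \<Rightarrow> nat \<Rightarrow> complex set" where
  "L_field t W k n = QQ_adjoin (\<Union>l\<in>{l. Factorial_Ring.prime l \<and> l dvd n}. L_prime t W k l)"

definition FL_field ::
  "nat \<Rightarrow> (nat \<Rightarrow> complex set) \<Rightarrow> (nat \<Rightarrow> nat) \<Rightarrow> complex set \<Rightarrow> nat \<Rightarrow> complex set" where
  "FL_field t W k F n = QQ_adjoin (F \<union> L_field t W k n)"

definition C_set ::
  "nat \<Rightarrow> (nat \<Rightarrow> complex set) \<Rightarrow> (nat \<Rightarrow> nat) \<Rightarrow> complex set \<Rightarrow> (complex \<Rightarrow> complex) set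
     \<Rightarrow> nat \<Rightarrow> (complex \<Rightarrow> complex) set" where
  "C_set t W k F C n =
     {\<sigma> \<in> carrier (galois_group (FL_field t W k F n) \<rat>).
        restrict \<sigma> F \<in> C \<and>
        (\<forall>i\<in>{1..t}. \<forall>l. Factorial_Ring.prime l \<and> l dvd n \<longrightarrow> \<not> (\<forall>x\<in>K_field W k i l. \<sigma> x = x))}"

definition dens ::
  "nat \<Rightarrow> (nat \<Rightarrow> complex set) \<Rightarrow> (nat \<Rightarrow> nat) \<Rightarrow> complex set \<Rightarrow> (complex \<Rightarrow> complex) set
     \<Rightarrow> nat \<Rightarrow> real" where
  "dens t W k F C n =
     real (card (C_set t W k F C n)) / real (Coset.order (galois_group (FL_field t W k F n) \<rat>))"

text \<open>The squarefree positive integers directed by divisibility (note that 0 is not squarefree).\<close>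

definition at_squarefree :: "nat filter" where
  "at_squarefree = (INF n\<in>{n. squarefree n}. principal {m. squarefree m \<and> n dvd m})"

definition dens_infinity ::
  "nat \<Rightarrow> (nat \<Rightarrow> complex set) \<Rightarrow> (nat \<Rightarrow> nat) \<Rightarrow> complex set \<Rightarrow> (complex \<Rightarrow> complex) set
     \<Rightarrow> real" where
  "dens_infinity t W k F C = Lim at_squarefree (dens t W k F C)"

end

theory Submission
  imports Defs "HOL-Number_Theory.Number_Theory"
begin

text \<open>
  Let \<open>G\<close> be the automorphism group of the field of algebraic numbers, \<open>c\<close> complex conjugation,
  and let \<open>\<ell>\<close> be a large prime not dividing \<open>n\<close>. Among the extensions to \<open>FL\<^sub>n\<^sub>\<ell>\<close> of a given
  \<open>\<sigma> \<in> C\<^sub>n\<close>, the proportion of those trivial on \<open>\<rat>(\<zeta>\<^sub>\<ell>, W\<^sub>i\<^sup>1\<^sup>/\<^sup>\<ell>)\<close> is at most the reciprocal of the number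
  of conjugates of \<open>(\<zeta>\<^sub>\<ell>, \<theta>)\<close> over \<open>FL\<^sub>n\<close>, where \<open>\<theta>\<close> is an irrational real \<open>\<ell>\<close>-th root of an element
  of \<open>W\<^sub>i\<close>. That number is bounded below by \<open>\<ell> (\<ell> - 1) / (2 f!)\<close>, where \<open>f = [F : \<rat>]\<close>, without
  any ramification theory. If \<open>g \<in> G\<close> moves \<open>\<theta>\<close>, then \<open>g c g\<^sup>-\<^sup>1 c\<^sup>-\<^sup>1\<close> moves \<open>\<theta>\<close> as well, but fixes
  all roots of unity, and a power of it with exponent prime to \<open>\<ell>\<close> fixes \<open>FL\<^sub>n\<close>. If \<open>v \<in> G\<close> fixes
  enough roots of unity of order prime to \<open>\<ell>\<close>, then \<open>v c v c\<close> fixes \<open>L\<^sub>n\<close>, its power with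
  exponent \<open>f!\<close> fixes \<open>FL\<^sub>n\<close>, and it acts on \<open>\<zeta>\<^sub>\<ell>\<close> by an exponent that is a \<open>2 f!\<close>-th power; by the
  irreducibility of cyclotomic polynomials, all \<open>2 f!\<close>-th powers modulo \<open>\<ell>\<close> occur.
  Hence \<open>d\<^sub>n\<^sub>\<ell> \<ge> (1 - 2 t f! / (\<ell> (\<ell> - 1))) d\<^sub>n\<close>, and the product of these factors over all large \<open>\<ell>\<close> is
  positive.
\<close>

section \<open>Algebraic numbers\<close>

lemma CC_simps [simp]:
  "carrier CC = UNIV" "x \<otimes>\<^bsub>CC\<^esub> y = x * y" "x \<oplus>\<^bsub>CC\<^esub> y = x + y" "\<one>\<^bsub>CC\<^esub> = 1" "\<zero>\<^bsub>CC\<^esub> = 0"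
  by (simp_all add: ring_of_type_algebra_def)

lemma field_CC: "field CC"
  by (rule field_from_type_algebra)

lemmas domain_CC = field.axioms(1)[OF field_CC]
lemmas cring_CC = domain.axioms(1)[OF domain_CC]
lemmas ring_CC = cring.axioms(1)[OF cring_CC]
lemmas comm_monoid_CC = cring.axioms(2)[OF cring_CC]

lemma CC_a_inv [simp]: "\<ominus>\<^bsub>CC\<^esub> x = - x"
  using abelian_group.r_neg[OF ring.is_abelian_group[OF ring_CC], of x]
  by (simp add: eq_neg_iff_add_eq_0 add.commute)

lemma CC_m_inv [simp]: "x \<noteq> 0 \<Longrightarrow> inv\<^bsub>CC\<^esub> x = inverse x"
  by (rule comm_monoid.comm_inv_char[OF comm_monoid_CC]) auto

lemma subfield_Rats: "subfield \<rat> CC"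
  by (rule field.subfieldI'[OF field_CC ring.subringI[OF ring_CC]]) auto

lemma CC_pow [simp]: "x [^]\<^bsub>CC\<^esub> (n::nat) = x ^ n"
  by (induction n) (simp_all add: monoid.nat_pow_Suc[OF ring.is_monoid[OF ring_CC]] 
      monoid.nat_pow_0[OF ring.is_monoid[OF ring_CC]] mult.commute)

lemma CC_eval: "ring.eval CC p x = poly (Poly (rev p)) x"
  by (induction p) (simp_all add: ring.eval.simps[OF ring_CC] Poly_append poly_monom algebra_simps)

text \<open>The link to the polynomials of HOL-Algebra, which are coefficient lists with the leading
  coefficient first, hence \<open>rev\<close>. It imports the fact that the algebraic numbers form a
  field.\<close>

lemma algebraic_iff_CC: "(ring.algebraic CC over \<rat>) x \<longleftrightarrow> algebraic (x::complex)"
proof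
  assume "(ring.algebraic CC over \<rat>) x"
  then obtain p where p: "p \<in> carrier (\<rat>[X]\<^bsub>CC\<^esub>)" "p \<noteq> []" "ring.eval CC p x = \<zero>\<^bsub>CC\<^esub>"
    using domain.algebraicE[OF domain_CC subfieldE(1)[OF subfield_Rats]] by auto
  have pol: "set p \<subseteq> \<rat>" "hd p \<noteq> 0"
    using p by (auto simp: univ_poly_carrier[symmetric] polynomial_def)
  show "algebraic x"
  proof (rule algebraicI')
    show "coeff (Poly (rev p)) i \<in> \<rat>" for i
      using pol p(2) by (auto simp: nth_default_def rev_nth subset_iff)
    have "coeff (Poly (rev p)) (length p - 1) = hd p"
      using p(2) by (simp add: nth_default_def rev_nth hd_conv_nth)
    then show "Poly (rev p) \<noteq> 0" using pol by (metis coeff_0)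
    show "poly (Poly (rev p)) x = 0" using p(3) by (simp add: CC_eval)
  qed
next
  assume "algebraic x"
  then obtain p where p: "\<And>i. coeff p i \<in> \<rat>" "p \<noteq> 0" "poly p x = 0"
    by (auto simp: algebraic_altdef)
  show "(ring.algebraic CC over \<rat>) x"
  proof (rule ring.algebraicI[OF ring_CC])
    show "rev (coeffs p) \<in> carrier (\<rat>[X]\<^bsub>CC\<^esub>)"
      using p by (auto simp: univ_poly_carrier[symmetric] polynomial_def hd_rev last_coeffs_eq_coeff_degree)
         (auto simp: coeffs_def)
    show "rev (coeffs p) \<noteq> []" using p by simp
    show "ring.eval CC (rev (coeffs p)) x = \<zero>\<^bsub>CC\<^esub>"
      using p by (simp add: CC_eval)
  qed
qed

lemma subfield_algebraic: "subfield {x::complex. algebraic x} CC"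
  using field.subfield_of_algebraics[OF field_CC subfield_Rats] by (simp add: algebraic_iff_CC)

lemma algebraic_add: "algebraic (x::complex) \<Longrightarrow> algebraic y \<Longrightarrow> algebraic (x + y)"
  using subringE(7)[OF subfieldE(1)[OF subfield_algebraic]] by simp

lemma algebraic_mult: "algebraic (x::complex) \<Longrightarrow> algebraic y \<Longrightarrow> algebraic (x * y)"
  using subringE(6)[OF subfieldE(1)[OF subfield_algebraic]] by simp

lemma algebraic_sum: "(\<And>i. i \<in> I \<Longrightarrow> algebraic (f i :: complex)) \<Longrightarrow> algebraic (sum f I)"
  by (induction I rule: infinite_finite_induct) (auto intro: algebraic_add)

lemma algebraic_power: "algebraic (x::complex) \<Longrightarrow> algebraic (x ^ n)"
  by (induction n) (auto intro: algebraic_mult rat_imp_algebraic)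

lemma algebraic_of_power: 
  assumes "algebraic (x ^ n :: complex)" "n > 0" shows "algebraic x"
  by (rule algebraic_root[OF assms(1), of "monom 1 n"]) (use assms(2) in \<open>auto simp: poly_monom degree_monom_eq\<close>)

section \<open>Extension of field embeddings\<close>

text \<open>
  Graphs of ring homomorphisms into \<open>\<complex>\<close> from rings of algebraic numbers containing \<open>\<rat>\<close>.
  Closure under inverses and injectivity come for free, because the inverse of an algebraic
  number is a rational polynomial in it.
\<close>

definition partial_hom :: "(complex \<times> complex) set \<Rightarrow> bool" where
  "partial_hom R \<longleftrightarrow> (\<forall>q\<in>\<rat>. (q, q) \<in> R) \<and>
     (\<forall>a b c d. (a, b) \<in> R \<longrightarrow> (c, d) \<in> R \<longrightarrow> (a + c, b + d) \<in> R \<and> (a * c, b * d) \<in> R) \<and>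
     (\<forall>b. (0, b) \<in> R \<longrightarrow> b = 0) \<and> (\<forall>a b. (a, b) \<in> R \<longrightarrow> algebraic a)"

text \<open>Reading \<open>R\<close> as a homomorphism, \<open>Q\<close> is the image of
  \<open>P\<close> under its action on coefficients. The relational form spares any bookkeeping
  about the domain of \<open>R\<close>.\<close>

definition paired :: "(complex \<times> complex) set \<Rightarrow> complex poly \<Rightarrow> complex poly \<Rightarrow> bool" where
  "paired R P Q \<longleftrightarrow> (\<forall>i. (coeff P i, coeff Q i) \<in> R)"

context
  fixes R assumes R: "partial_hom R"
begin

lemma ph_rat: "q \<in> \<rat> \<Longrightarrow> (q, q) \<in> R"
  and ph_add: "(a, b) \<in> R \<Longrightarrow> (c, d) \<in> R \<Longrightarrow> (a + c, b + d) \<in> R"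
  and ph_mult: "(a, b) \<in> R \<Longrightarrow> (c, d) \<in> R \<Longrightarrow> (a * c, b * d) \<in> R"
  and ph_0: "(0, b) \<in> R \<Longrightarrow> b = 0"
  and ph_algebraic: "(a, b) \<in> R \<Longrightarrow> algebraic a"
  using R unfolding partial_hom_def by blast+

lemma ph_minus: "(a, b) \<in> R \<Longrightarrow> (- a, - b) \<in> R"
  using ph_mult[OF ph_rat[of "-1"]] by simp

lemma ph_diff: "(a, b) \<in> R \<Longrightarrow> (c, d) \<in> R \<Longrightarrow> (a - c, b - d) \<in> R"
  using ph_add[OF _ ph_minus] by fastforce

lemma ph_unique: "(a, b) \<in> R \<Longrightarrow> (a, c) \<in> R \<Longrightarrow> b = c"
  using ph_diff[of a b a c] ph_0[of "b - c"] by simp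

lemma ph_sum: "(\<And>i. i \<in> I \<Longrightarrow> (f i, g i) \<in> R) \<Longrightarrow> (sum f I, sum g I) \<in> R"
  by (induction I rule: infinite_finite_induct) (auto intro: ph_add ph_rat)

lemma ph_poly_rat:
  assumes "\<And>i. coeff p i \<in> \<rat>" "(a, b) \<in> R" shows "(poly p a, poly p b) \<in> R"
  using assms(1)
proof (induction p)
  case (pCons c p)
  have "c \<in> \<rat>" using pCons.prems[of 0] by simp
  moreover have "coeff p i \<in> \<rat>" for i using pCons.prems[of "Suc i"] by simp
  ultimately show ?case using pCons.IH assms(2) by (auto intro!: ph_add ph_mult ph_rat)
qed (auto intro: ph_rat)

end

text \<open>In a rational annihilating polynomial of least degree the constant term \<open>c\<close>
  is nonzero, for otherwise a factor X could be cancelled. Solving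
  \<open>c + a * poly q a = 0\<close> for the inverse of \<open>a\<close> gives
  \<open>r\<close>.\<close>

lemma algebraic_inverse_poly:
  assumes "algebraic (a::complex)" "a \<noteq> 0"
  obtains r where "\<And>i. coeff r i \<in> \<rat>" "inverse a = poly r a"
proof -
  let ?A = "\<lambda>p. (\<forall>i. coeff p i \<in> \<rat>) \<and> p \<noteq> 0 \<and> poly p a = 0"
  obtain p0 where "?A p0" using assms(1) by (auto simp: algebraic_altdef)
  then obtain p where p: "\<forall>i. coeff p i \<in> \<rat>" "p \<noteq> 0" "poly p a = 0"
    and min: "\<And>p'. ?A p' \<Longrightarrow> degree p \<le> degree p'"
    using ex_has_least_nat[of ?A p0 degree] by blast
  obtain c q where cq: "p = pCons c q" by (cases p)
  have c: "c \<in> \<rat>" and q: "coeff q i \<in> \<rat>" for i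
    using p(1)[rule_format, of 0] p(1)[rule_format, of "Suc i"] cq by auto
  have eq: "c + a * poly q a = 0" using p cq by simp
  have "c \<noteq> 0"
  proof
    assume "c = 0"
    then have "q \<noteq> 0" "poly q a = 0" using p cq eq assms(2) by auto
    from min[of q] this q cq show False by auto
  qed
  have "a * poly q a = - c" using eq by (simp add: add_eq_0_iff)
  then have "inverse a = poly (smult (- inverse c) q) a"
    using assms(2) \<open>c \<noteq> 0\<close> by (simp add: field_simps)
  then show ?thesis using that[of "smult (- inverse c) q"] c q by auto
qed

context
  fixes R assumes R: "partial_hom R"
begin

text \<open>With \<open>inverse a = poly r a\<close> and \<open>r\<close> rational, \<open>R\<close>
  contains \<open>(a * poly r a, b * poly r b)\<close>. The first component is 1, so the second is 1
  as well.\<close>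

lemma ph_inverse: "(a, b) \<in> R \<Longrightarrow> (inverse a, inverse b) \<in> R"
  and ph_0_iff: "(a, b) \<in> R \<Longrightarrow> a = 0 \<longleftrightarrow> b = 0"
proof -
  have *: "(inverse a, inverse b) \<in> R \<and> b \<noteq> 0" if ab: "(a, b) \<in> R" and "a \<noteq> 0"
  proof -
    obtain r where r: "\<And>i. coeff r i \<in> \<rat>" "inverse a = poly r a"
      using algebraic_inverse_poly ph_algebraic[OF R ab] \<open>a \<noteq> 0\<close> by metis
    have 1: "(inverse a, poly r b) \<in> R" using ph_poly_rat[OF R r(1) ab] r(2) by simp
    from ph_mult[OF R ab this] have "b * poly r b = 1"
      using ph_unique[OF R] ph_rat[OF R, of 1] \<open>a \<noteq> 0\<close> by auto
    then show ?thesis using 1 by (metis inverse_unique mult_zero_left zero_neq_one)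
  qed
  show "(inverse a, inverse b) \<in> R" if "(a, b) \<in> R"
    using *[OF that] that ph_0[OF R, of b] by (cases "a = 0") auto
  show "a = 0 \<longleftrightarrow> b = 0" if "(a, b) \<in> R"
    using * ph_0[OF R] that by auto
qed

lemma paired_add: "paired R P Q \<Longrightarrow> paired R P' Q' \<Longrightarrow> paired R (P + P') (Q + Q')"
  by (auto simp: paired_def intro: ph_add[OF R])

lemma paired_diff: "paired R P Q \<Longrightarrow> paired R P' Q' \<Longrightarrow> paired R (P - P') (Q - Q')"
  by (auto simp: paired_def intro: ph_diff[OF R])

lemma paired_mult: "paired R P Q \<Longrightarrow> paired R P' Q' \<Longrightarrow> paired R (P * P') (Q * Q')"
  by (auto simp: paired_def coeff_mult intro!: ph_sum[OF R] ph_mult[OF R])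

lemma paired_monom: "(a, b) \<in> R \<Longrightarrow> paired R (monom a n) (monom b n)"
  by (auto simp: paired_def intro: ph_rat[OF R])

lemma paired_0: "paired R 0 Q \<Longrightarrow> Q = 0"
  using ph_0[OF R] by (simp add: paired_def poly_eq_iff)

lemma paired_const: "(a, b) \<in> R \<Longrightarrow> paired R [:a:] [:b:]"
  using paired_monom[of a b 0] by (simp add: monom_0)

lemma paired_rat: "(\<And>i. coeff P i \<in> \<rat>) \<Longrightarrow> paired R P P"
  by (auto simp: paired_def intro: ph_rat[OF R])

lemma paired_degree:
  assumes "paired R P Q" shows "degree P = degree Q"
proof -
  have "coeff P i = 0 \<longleftrightarrow> coeff Q i = 0" for i
    using assms ph_0_iff by (auto simp: paired_def)
  then show ?thesis by (simp add: degree_def)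
qed

text \<open>The extension to the ring generated by \<alpha> sends \<open>poly P \<alpha>\<close> to
  \<open>poly Q \<beta>\<close>. The assumption \<open>vanish\<close> is the zero condition of
  \<open>partial_hom\<close>, which makes this well defined.\<close>

lemma simple_extension_hom:
  assumes \<alpha>: "algebraic \<alpha>"
    and vanish: "\<And>P Q. paired R P Q \<Longrightarrow> poly P \<alpha> = 0 \<Longrightarrow> poly Q \<beta> = 0"
  obtains R' where "partial_hom R'" "R \<subseteq> R'" "(\<alpha>, \<beta>) \<in> R'"
proof
  let ?R = "{(poly P \<alpha>, poly Q \<beta>) | P Q. paired R P Q}"
  have sub: "R \<subseteq> ?R"
  proof clarify
    fix a b assume "(a, b) \<in> R"
    from paired_const[OF this] show "\<exists>P Q. (a, b) = (poly P \<alpha>, poly Q \<beta>) \<and> paired R P Q"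
      by (intro exI[of _ "[:a:]"] exI[of _ "[:b:]"]) simp
  qed
  have alg: "algebraic (poly P \<alpha>)" if "paired R P Q" for P Q
    unfolding poly_altdef using that ph_algebraic[OF R] \<alpha>
    by (intro algebraic_sum algebraic_mult algebraic_power) (auto simp: paired_def)
  show "partial_hom ?R" unfolding partial_hom_def
  proof (intro conjI allI impI ballI)
    show "(q, q) \<in> ?R" if "q \<in> \<rat>" for q using ph_rat[OF R that] sub by blast
  next
    fix a b c d assume "(a, b) \<in> ?R" "(c, d) \<in> ?R"
    then obtain P Q P' Q' where *: "paired R P Q" "paired R P' Q'"
      and [simp]: "a = poly P \<alpha>" "b = poly Q \<beta>" "c = poly P' \<alpha>" "d = poly Q' \<beta>" by blast
    show "(a + c, b + d) \<in> ?R" using paired_add[OF *]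
      by (intro CollectI exI[of _ "P + P'"] exI[of _ "Q + Q'"]) simp
    show "(a * c, b * d) \<in> ?R" using paired_mult[OF *]
      by (intro CollectI exI[of _ "P * P'"] exI[of _ "Q * Q'"]) simp
  next
    fix b assume "(0, b) \<in> ?R" then show "b = 0" using vanish by auto
  next
    fix a b assume "(a, b) \<in> ?R" then show "algebraic a" using alg by blast
  qed
  show "R \<subseteq> ?R" by fact
  have "paired R [:0, 1:] [:0, 1:]" by (rule paired_rat) (auto simp: coeff_pCons split: nat.splits)
  then show "(\<alpha>, \<beta>) \<in> ?R" by (intro CollectI exI[of _ "[:0, 1:]"]) simp
qed

text \<open>\<open>P0\<close> serves as the minimal polynomial of \<alpha> over the domain of
  \<open>R\<close>, and \<open>Q0\<close> is its image. Dividing \<open>P\<close> by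
  \<open>P0\<close> and \<open>Q\<close> by \<open>Q0\<close> in parallel shows that every root of
  \<open>Q0\<close> is an admissible image of \<alpha>.\<close>

lemma minimal_pair:
  assumes \<alpha>: "algebraic \<alpha>"
  obtains P0 Q0 where "paired R P0 Q0" "P0 \<noteq> 0" "poly P0 \<alpha> = 0"
    "\<And>P Q. paired R P Q \<Longrightarrow> P \<noteq> 0 \<Longrightarrow> poly P \<alpha> = 0 \<Longrightarrow> degree P0 \<le> degree P"
    "\<And>P Q \<beta>. paired R P Q \<Longrightarrow> poly P \<alpha> = 0 \<Longrightarrow> poly Q0 \<beta> = 0 \<Longrightarrow> poly Q \<beta> = 0"
proof -
  let ?A = "\<lambda>(P, Q). paired R P Q \<and> P \<noteq> 0 \<and> poly P \<alpha> = 0"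
  obtain p where "\<forall>i. coeff p i \<in> \<rat>" "p \<noteq> 0" "poly p \<alpha> = 0"
    using \<alpha> by (auto simp: algebraic_altdef)
  then have "?A (p, p)" by (auto intro: paired_rat)
  from ex_has_least_nat[of ?A, OF this, of "\<lambda>x. degree (fst x)"]
  obtain p0 where X: "?A p0" "\<forall>y. ?A y \<longrightarrow> degree (fst p0) \<le> degree (fst y)" by blast
  obtain P0 Q0 where XPQ: "p0 = (P0, Q0)" by (cases p0)
  have P0: "paired R P0 Q0" "P0 \<noteq> 0" "poly P0 \<alpha> = 0"
    using X(1) unfolding XPQ by simp_all
  have min: "degree P0 \<le> degree P" if "?A (P, Q)" for P Q
    using X(2) that unfolding XPQ by force
  have "poly Q \<beta> = 0" if "paired R P Q" "poly P \<alpha> = 0" and \<beta>: "poly Q0 \<beta> = 0" for P Q \<beta>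
    using that(1,2)
  proof (induction "degree P" arbitrary: P Q rule: less_induct)
    case less
    show ?case
    proof (cases "P = 0")
      case True
      then have "Q = 0" using less.prems(1) paired_0 by simp
      then show ?thesis by simp
    next
      case False
      then have deg: "degree P0 \<le> degree P" using min[of P Q] less.prems by auto
      \<comment> \<open>One step of long division on both sides at once: subtracting
        \<open>M * P0\<close> cancels the leading term of \<open>P\<close>, and \<open>N\<close> is
        the image of \<open>M\<close>.\<close>
      define k where "k = degree P - degree P0"
      define M where "M = monom (lead_coeff P * inverse (lead_coeff P0)) k"
      define N where "N = monom (lead_coeff Q * inverse (lead_coeff Q0)) k"
      have MN: "paired R M N" unfolding M_def N_def
        using less.prems(1) P0(1) paired_degree[OF P0(1)] paired_degree[OF less.prems(1)]
        by (intro paired_monom ph_mult[OF R] ph_inverse) (auto simp: paired_def)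
      have 1: "paired R (P - M * P0) (Q - N * Q0)"
        by (intro paired_diff paired_mult MN less.prems P0)
      have z: "poly (P - M * P0) \<alpha> = 0" using less.prems P0 by simp
      have lM: "lead_coeff M = lead_coeff P * inverse (lead_coeff P0)" "degree M = degree P - degree P0"
        and M0: "M \<noteq> 0"
        using P0(2) False by (simp_all add: M_def k_def degree_monom_eq monom_eq_0_iff)
      then have Mdeg: "degree (M * P0) = degree P"
        using P0(2) deg by (simp add: degree_mult_eq)
      have lc: "coeff (M * P0) (degree P) = lead_coeff P"
        unfolding Mdeg[symmetric] lead_coeff_mult lM(1) using P0(2) by simp
      have "poly (Q - N * Q0) \<beta> = 0"
      proof (cases "P - M * P0 = 0")
        case True
        then have "Q - N * Q0 = 0" using 1 by (intro paired_0) simp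
        then show ?thesis by simp
      next
        case F: False
        have "degree (P - M * P0) \<le> degree P" using Mdeg by (metis degree_diff_le order_refl)
        moreover have "coeff (P - M * P0) (degree P) = 0" using lc Mdeg by simp
        ultimately have "degree (P - M * P0) < degree P"
          using F by (metis le_neq_implies_less leading_coeff_0_iff)
        then show ?thesis using less.hyps[OF _ 1 z] by blast
      qed
      then show ?thesis using \<beta> by simp
    qed
  qed
  then show ?thesis using that P0 min by blast
qed

text \<open>\<open>P0\<close> is not constant, so neither is its image \<open>Q0\<close>, which
  therefore has a complex root \<beta>.\<close>

lemma extension_step:
  assumes \<alpha>: "algebraic \<alpha>"
  obtains R' \<beta> where "partial_hom R'" "R \<subseteq> R'" "(\<alpha>, \<beta>) \<in> R'"
proof -
  obtain P0 Q0 where P0: "paired R P0 Q0" "P0 \<noteq> 0" "poly P0 \<alpha> = 0"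
    and vanish: "\<And>P Q \<beta>. paired R P Q \<Longrightarrow> poly P \<alpha> = 0 \<Longrightarrow> poly Q0 \<beta> = 0 \<Longrightarrow> poly Q \<beta> = 0"
    by (rule minimal_pair[OF \<alpha>]) blast
  have "degree P0 \<noteq> 0"
  proof
    assume "degree P0 = 0"
    then obtain c where "P0 = [:c:]" by (rule degree_eq_zeroE)
    with P0(2,3) show False by simp
  qed
  then have "\<not> constant (poly Q0)" 
    using paired_degree[OF P0(1)] by (simp add: constant_degree)
  then obtain \<beta> where \<beta>: "poly Q0 \<beta> = 0"
    using fundamental_theorem_of_algebra by blast
  show ?thesis by (rule simple_extension_hom[OF \<alpha> vanish[OF _ _ \<beta>]]) (assumption | rule that)+
qed

end

text \<open>Values at transcendental numbers are left free, so that \<open>cnj\<close> and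
  composites are members without being restricted.\<close>

definition Aut_Qbar :: "(complex \<Rightarrow> complex) set" where
  "Aut_Qbar = {g. bij_betw g {x. algebraic x} {x. algebraic x} \<and>
     (\<forall>x y. algebraic x \<longrightarrow> algebraic y \<longrightarrow> g (x + y) = g x + g y \<and> g (x * y) = g x * g y)}"

text \<open>Surjectivity comes from finiteness: the injective map \<open>g\<close> permutes the
  roots of a rational polynomial that vanishes at the given \<open>y\<close>.\<close>

lemma total_hom_in_Aut_Qbar:
  assumes R: "partial_hom R" and g: "\<And>x. algebraic x \<Longrightarrow> (x, g x) \<in> R"
  shows "g \<in> Aut_Qbar"
proof -
  have add: "g (x + y) = g x + g y" and mult: "g (x * y) = g x * g y" if "algebraic x" "algebraic y" for x y
    using ph_unique[OF R] g ph_add[OF R] ph_mult[OF R] algebraic_add algebraic_mult that by metis+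
  have root: "poly p (g x) = 0" if "\<And>i. coeff p i \<in> \<rat>" "poly p x = 0" "algebraic x" for p x
    using ph_poly_rat[OF R that(1) g[OF that(3)]] that(2) ph_0[OF R] by auto
  have alg: "algebraic (g x)" if x: "algebraic x" for x
  proof -
    obtain p where "\<forall>i. coeff p i \<in> \<rat>" "p \<noteq> 0" "poly p x = 0"
      using x by (auto simp: algebraic_altdef)
    with root[of p x] x show ?thesis by (auto simp: algebraic_altdef)
  qed
  have inj: "inj_on g {x. algebraic x}"
  proof (rule inj_onI, clarify)
    fix x y assume "algebraic x" "algebraic y" "g x = g y"
    then have "(x - y, 0) \<in> R" using ph_diff[OF R g g, of x y] by simp
    then show "x = y" using ph_0_iff[OF R, of "x - y" 0] by simp
  qed
  have surj: "\<exists>x. algebraic x \<and> g x = y" if y: "algebraic y" for y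
  proof -
    obtain p where p: "\<forall>i. coeff p i \<in> \<rat>" "p \<noteq> 0" "poly p y = 0"
      using y by (auto simp: algebraic_altdef)
    let ?Z = "{x. poly p x = 0}"
    have Z: "?Z \<subseteq> {x. algebraic x}" using p by (auto simp: algebraic_altdef)
    have "g ` ?Z = ?Z"
    proof (rule endo_inj_surj)
      show "finite ?Z" using p by (simp add: poly_roots_finite)
      show "g ` ?Z \<subseteq> ?Z" using root p Z by auto
      show "inj_on g ?Z" using inj Z inj_on_subset by blast
    qed
    then have "y \<in> g ` ?Z" using p by simp
    then show ?thesis using Z by blast
  qed
  have "bij_betw g {x. algebraic x} {x. algebraic x}"
    by (intro bij_betw_imageI inj equalityI subsetI) (use alg surj in blast)+
  with add mult show ?thesis by (simp add: Aut_Qbar_def)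
qed

text \<open>Zorn's lemma yields a maximal extension of \<open>R\<close>; by
  \<open>extension_step\<close> its domain contains all algebraic numbers.\<close>

theorem partial_hom_extends:
  assumes R: "partial_hom R"
  obtains g where "g \<in> Aut_Qbar" "\<And>a b. (a, b) \<in> R \<Longrightarrow> g a = b"
proof -
  let ?A = "{R'. partial_hom R' \<and> R \<subseteq> R'}"
  have "\<exists>M\<in>?A. \<forall>Y\<in>?A. M \<subseteq> Y \<longrightarrow> Y = M"
  proof (rule subset_Zorn_nonempty)
    show "?A \<noteq> {}" using R by blast
    fix \<C> assume ne: "\<C> \<noteq> {}" and ch: "subset.chain ?A \<C>"
    have sub: "\<C> \<subseteq> ?A" and tot: "\<forall>Y\<in>\<C>. \<forall>Y'\<in>\<C>. Y \<subseteq> Y' \<or> Y' \<subseteq> Y"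
      using ch[unfolded subset_chain_def] by simp_all
    have A: "partial_hom Y \<and> R \<subseteq> Y" if "Y \<in> \<C>" for Y
      using subsetD[OF sub that] by simp
    have two: "\<exists>Z\<in>\<C>. Y \<subseteq> Z \<and> Y' \<subseteq> Z" if "Y \<in> \<C>" "Y' \<in> \<C>" for Y Y'
      using tot that by (metis order_refl)
    have "partial_hom (\<Union>\<C>)" unfolding partial_hom_def
    proof (intro conjI allI impI ballI)
      obtain Y where Y: "Y \<in> \<C>" using ne by auto
      show "(q, q) \<in> \<Union>\<C>" if "q \<in> \<rat>" for q
        using ph_rat[of Y, OF _ that] A[OF Y] Y by (intro UnionI[of Y]) auto
    next
      fix a b c d assume "(a, b) \<in> \<Union>\<C>" "(c, d) \<in> \<Union>\<C>"
      then obtain Z where Z: "Z \<in> \<C>" "(a, b) \<in> Z" "(c, d) \<in> Z" using two by blast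
      have "partial_hom Z" using A[OF Z(1)] by simp
      from ph_add[OF this Z(2,3)] ph_mult[OF this Z(2,3)] Z(1)
      show "(a + c, b + d) \<in> \<Union>\<C>" "(a * c, b * d) \<in> \<Union>\<C>"
        by (simp_all only: Union_iff) blast+
    next
      fix b assume "(0, b) \<in> \<Union>\<C>"
      then obtain Y where Y: "Y \<in> \<C>" "(0, b) \<in> Y" by blast
      show "b = 0" using ph_0[OF _ Y(2)] A[OF Y(1)] by simp
    next
      fix a b assume "(a, b) \<in> \<Union>\<C>"
      then obtain Y where Y: "Y \<in> \<C>" "(a, b) \<in> Y" by blast
      show "algebraic a" using ph_algebraic[OF _ Y(2)] A[OF Y(1)] by simp
    qed
    moreover have "R \<subseteq> \<Union>\<C>" using ne A by (metis Union_upper ex_in_conv order_trans)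
    ultimately show "\<Union>\<C> \<in> ?A" by simp
  qed
  then obtain M where "M \<in> ?A" and "\<forall>Y\<in>?A. M \<subseteq> Y \<longrightarrow> Y = M" ..
  then have M: "partial_hom M" "R \<subseteq> M"
    and max: "\<And>Y. partial_hom Y \<Longrightarrow> M \<subseteq> Y \<Longrightarrow> Y = M" by auto
  have "\<exists>y. (x, y) \<in> M" if x: "algebraic x" for x
  proof -
    obtain R' y where R': "partial_hom R'" "M \<subseteq> R'" "(x, y) \<in> R'"
      by (rule extension_step[OF M(1) x])
    then show ?thesis using max[OF R'(1,2)] by blast
  qed
  then obtain g where g: "\<And>x. algebraic x \<Longrightarrow> (x, g x) \<in> M" by metis
  have "g \<in> Aut_Qbar" by (rule total_hom_in_Aut_Qbar[OF M(1) g])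
  moreover have "g a = b" if "(a, b) \<in> R" for a b
  proof -
    have "(a, b) \<in> M" using that M(2) by blast
    then show ?thesis using ph_unique[OF M(1) g] ph_algebraic[OF M(1)] by blast
  qed
  ultimately show ?thesis using that by blast
qed

section \<open>Automorphisms of the field of algebraic numbers\<close>

context
  fixes g assumes g: "g \<in> Aut_Qbar"
begin

lemma aut_bij: "bij_betw g {x. algebraic x} {x. algebraic x}"
  and aut_add: "algebraic x \<Longrightarrow> algebraic y \<Longrightarrow> g (x + y) = g x + g y"
  and aut_mult: "algebraic x \<Longrightarrow> algebraic y \<Longrightarrow> g (x * y) = g x * g y"
  using g by (auto simp: Aut_Qbar_def)

lemma aut_algebraic: "algebraic x \<Longrightarrow> algebraic (g x)"
  using aut_bij bij_betwE by blast

lemma aut_eq_iff: "algebraic x \<Longrightarrow> algebraic y \<Longrightarrow> g x = g y \<longleftrightarrow> x = y"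
  using aut_bij by (auto simp: bij_betw_def inj_on_def)

lemma aut_0 [simp]: "g 0 = 0"
  using aut_add[of 0 0] by simp

lemma aut_1 [simp]: "g 1 = 1"
proof -
  have "g 1 * g 1 = g 1" using aut_mult[of 1 1] by (simp add: rat_imp_algebraic)
  moreover have "g 1 \<noteq> 0" using aut_eq_iff[of 1 0] by (simp add: rat_imp_algebraic)
  ultimately show ?thesis by simp
qed

lemma aut_minus: "algebraic x \<Longrightarrow> g (- x) = - g x"
  using aut_add[of x "- x"] by (simp add: eq_neg_iff_add_eq_0 add.commute)

lemma aut_inverse: "algebraic x \<Longrightarrow> g (inverse x) = inverse (g x)"
proof (cases "x = 0")
  case False
  assume "algebraic x"
  with False aut_mult[of x "inverse x"] have "g x * g (inverse x) = 1" by auto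
  then show ?thesis by (metis inverse_unique)
qed simp

lemma aut_power: "algebraic x \<Longrightarrow> g (x ^ n) = g x ^ n"
  by (induction n) (simp_all add: aut_mult algebraic_power)

lemma aut_nat [simp]: "g (of_nat n) = of_nat n"
  by (induction n) (simp_all add: aut_add rat_imp_algebraic)

lemma aut_rat: "q \<in> \<rat> \<Longrightarrow> g q = q"
proof -
  have int: "g (of_int i) = of_int i" for i
    by (cases i rule: int_cases2) (simp_all add: aut_minus rat_imp_algebraic)
  assume "q \<in> \<rat>"
  then obtain a b where "q = of_int a / of_int b" by (auto elim: Rats_cases')
  then show ?thesis
    by (simp add: divide_inverse aut_mult aut_inverse int algebraic_inverse rat_imp_algebraic)
qed

lemma aut_poly_rat:
  assumes "\<And>i. coeff p i \<in> \<rat>" "algebraic x" 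
  shows "g (poly p x) = poly p (g x)"
  using assms(1)
proof (induction p)
  case (pCons c p)
  have c: "c \<in> \<rat>" and p: "coeff p i \<in> \<rat>" for i
    using pCons.prems[of 0] pCons.prems[of "Suc i"] by simp_all
  have "algebraic (poly p x)"
    unfolding poly_altdef using p assms(2) 
    by (intro algebraic_sum algebraic_mult algebraic_power) (auto intro: rat_imp_algebraic)
  then show ?case using pCons.IH[OF p] c assms(2)
    by (simp add: aut_add aut_mult aut_rat algebraic_mult rat_imp_algebraic)
qed simp

end

lemma aut_comp: "g \<in> Aut_Qbar \<Longrightarrow> h \<in> Aut_Qbar \<Longrightarrow> g \<circ> h \<in> Aut_Qbar"
  using bij_betw_trans[OF aut_bij[of h] aut_bij[of g]] unfolding Aut_Qbar_def
  by (auto simp: aut_algebraic Aut_Qbar_def)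

lemma aut_id: "(\<lambda>x. x) \<in> Aut_Qbar"
  unfolding Aut_Qbar_def by (auto simp: bij_betw_def)

lemma aut_funpow: "g \<in> Aut_Qbar \<Longrightarrow> g ^^ n \<in> Aut_Qbar"
  by (induction n) (auto intro: aut_comp simp: aut_id id_def)

lemma aut_cnj: "cnj \<in> Aut_Qbar"
  unfolding Aut_Qbar_def bij_betw_def inj_on_def
  by (auto simp: image_iff intro!: exI[of _ "cnj _"])

lemma aut_inv:
  assumes g: "g \<in> Aut_Qbar"
  obtains h where "h \<in> Aut_Qbar" "\<And>x. algebraic x \<Longrightarrow> g (h x) = x" "\<And>x. algebraic x \<Longrightarrow> h (g x) = x"
proof
  let ?Q = "{x::complex. algebraic x}"
  let ?h = "inv_into ?Q g"
  note b = bij_betw_inv_into[OF aut_bij[OF g]]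
  show gh: "g (?h x) = x" if "algebraic x" for x
    using bij_betw_inv_into_right[OF aut_bij[OF g], of x] that by simp
  show "?h (g x) = x" if "algebraic x" for x
    using bij_betw_inv_into_left[OF aut_bij[OF g], of x] that by simp
  have alg: "algebraic (?h x)" if "algebraic x" for x
    using bij_betwE[OF b] that by blast
  have "?h (x + y) = ?h x + ?h y" "?h (x * y) = ?h x * ?h y" if "algebraic x" "algebraic y" for x y
    using that by (auto simp: alg gh algebraic_add algebraic_mult aut_add[OF g] aut_mult[OF g]
        aut_eq_iff[OF g, symmetric])
  then show "?h \<in> Aut_Qbar" using b by (simp add: Aut_Qbar_def)
qed

section \<open>Galois conjugates over the rational numbers\<close>

lemma partial_hom_Id_Rats: "partial_hom (Id_on \<rat>)"
  by (auto simp: partial_hom_def Id_on_iff intro: rat_imp_algebraic)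

lemma paired_Id_Rats: "paired (Id_on \<rat>) P Q \<longleftrightarrow> P = Q \<and> (\<forall>i. coeff P i \<in> \<rat>)"
  by (auto simp: paired_def Id_on_iff poly_eq_iff)

text \<open>The identity of the rationals is extended first to \<alpha>, then to all algebraic
  numbers.\<close>

lemma conjugate_aut:
  assumes "algebraic \<alpha>"
    and "\<And>p. (\<And>i. coeff p i \<in> \<rat>) \<Longrightarrow> poly p \<alpha> = 0 \<Longrightarrow> poly p \<beta> = 0"
  obtains g where "g \<in> Aut_Qbar" "g \<alpha> = \<beta>"
proof -
  have vanish: "poly Q \<beta> = 0" if "paired (Id_on \<rat>) P Q" "poly P \<alpha> = 0" for P Q
    using that assms(2)[of P] by (auto simp: paired_Id_Rats)
  obtain R' where R': "partial_hom R'" "(\<alpha>, \<beta>) \<in> R'"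
    by (rule simple_extension_hom[OF partial_hom_Id_Rats assms(1) vanish])
  show ?thesis by (rule partial_hom_extends[OF R'(1)]) (use R'(2) that in blast)
qed

text \<open>The minimal polynomial of \<theta> has degree at least 2, and its derivative, being of
  smaller degree, does not vanish at \<theta>. So there is a different root \<beta>, to which
  \<theta> can be sent.\<close>

lemma irrational_moved:
  assumes "algebraic \<theta>" "\<theta> \<notin> \<rat>"
  obtains g where "g \<in> Aut_Qbar" "g \<theta> \<noteq> \<theta>"
proof -
  obtain p p' where pp: "paired (Id_on \<rat>) p p'" "p \<noteq> 0" "poly p \<theta> = 0"
    and min: "\<And>r r'. paired (Id_on \<rat>) r r' \<Longrightarrow> r \<noteq> 0 \<Longrightarrow> poly r \<theta> = 0 \<Longrightarrow> degree p \<le> degree r"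
    and vanish: "\<And>r r' \<beta>. paired (Id_on \<rat>) r r' \<Longrightarrow> poly r \<theta> = 0 \<Longrightarrow> poly p' \<beta> = 0 \<Longrightarrow> poly r' \<beta> = 0"
    by (rule minimal_pair[OF partial_hom_Id_Rats assms(1)]) blast
  then have p: "\<forall>i. coeff p i \<in> \<rat>" "p \<noteq> 0" "poly p \<theta> = 0" and [simp]: "p' = p"
    by (auto simp: paired_Id_Rats)
  obtain q where q: "p = [:-\<theta>, 1:] * q" using p(3) by (auto simp: poly_eq_0_iff_dvd)
  have q0: "q \<noteq> 0" using p(2) q by auto
  have deg: "degree p = Suc (degree q)" unfolding q using q0 by (subst degree_mult_eq) auto
  have "degree q \<noteq> 0"
  proof
    assume "degree q = 0"
    then obtain c where c: "q = [:c:]" by (rule degree_eq_zeroE)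
    then have "coeff p 0 = - \<theta> * c" "coeff p 1 = c" using q by simp_all
    with p(1) have "- \<theta> * c \<in> \<rat>" "c \<in> \<rat>" by metis+
    then have "- (- \<theta> * c) / c \<in> \<rat>" by (intro Rats_divide) (auto simp: Rats_minus_iff)
    moreover have "- (- \<theta> * c) / c = \<theta>" using q0 c by simp
    ultimately show False using assms(2) by simp
  qed
  then have "\<not> constant (poly q)" by (simp add: constant_degree)
  then obtain \<beta> where \<beta>: "poly q \<beta> = 0" using fundamental_theorem_of_algebra by blast
  have "\<beta> \<noteq> \<theta>"
  proof
    assume "\<beta> = \<theta>"
    then have "poly (pderiv p) \<theta> = 0" using \<beta> unfolding q pderiv_mult by simp
    moreover have "coeff (pderiv p) i \<in> \<rat>" for i using p(1) by (simp add: coeff_pderiv)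
    moreover have "pderiv p \<noteq> 0" using deg by (simp add: pderiv_eq_0_iff)
    ultimately have "degree p \<le> degree (pderiv p)"
      using min[of "pderiv p" "pderiv p"] by (simp add: paired_Id_Rats)
    then show False using deg by (simp add: degree_pderiv)
  qed
  have "poly p \<beta> = 0" using q \<beta> by simp
  then have vanish: "poly r \<beta> = 0" if "\<And>i. coeff r i \<in> \<rat>" "poly r \<theta> = 0" for r
    using vanish[of r r] that by (simp add: paired_Id_Rats)
  obtain g where "g \<in> Aut_Qbar" "g \<theta> = \<beta>" by (rule conjugate_aut[OF assms(1) vanish])
  with \<open>\<beta> \<noteq> \<theta>\<close> show ?thesis using that by metis
qed

section \<open>Automorphisms and roots of unity\<close>

lemma roots_of_unity_algebraic: "z ^ m = 1 \<Longrightarrow> m > 0 \<Longrightarrow> algebraic (z::complex)"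
  by (rule algebraic_of_power[of z m]) (auto simp: rat_imp_algebraic)

lemma zeta_power: "zeta m ^ j = cis (2 * pi * real j / real m)"
  unfolding zeta_def Complex.DeMoivre by (simp add: mult_ac)

lemma zeta_pow_self: "m > 0 \<Longrightarrow> zeta m ^ m = 1"
  by (simp add: zeta_power)

lemma root_unity_is_zeta_power:
  assumes "m > 0" "z ^ m = 1" obtains j where "z = zeta m ^ j" "j < m"
proof -
  have "z \<in> {z. z ^ m = 1}" using assms by simp
  also have "{z. z ^ m = 1} = (\<lambda>k. cis (2 * pi * real k / real m)) ` {..<m}"
    using Complex.bij_betw_roots_unity[OF assms(1)] by (simp add: bij_betw_def)
  finally show ?thesis using that zeta_power by auto
qed

lemma zeta_power_eq_iff:
  assumes "m > 0" shows "zeta m ^ i = zeta m ^ j \<longleftrightarrow> [i = j] (mod m)"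
proof -
  have *: "zeta m ^ i = zeta m ^ (i mod m)" for i
    by (metis mod_div_decomp zeta_pow_self[OF assms] power_add power_mult power_one mult_1 mult.commute)
  have inj: "inj_on (\<lambda>k. cis (2 * pi * real k / real m)) {..<m}"
    using Complex.bij_betw_roots_unity[OF assms(1)] by (simp add: bij_betw_def)
  have "zeta m ^ i = zeta m ^ j \<longleftrightarrow> zeta m ^ (i mod m) = zeta m ^ (j mod m)"
    using * by metis
  also have "\<dots> \<longleftrightarrow> i mod m = j mod m"
    using inj assms unfolding zeta_power inj_on_def by auto
  finally show ?thesis by (simp add: cong_def)
qed

lemma algebraic_zeta: "algebraic (zeta m)"
proof (cases "m = 0")
  case False then show ?thesis using roots_of_unity_algebraic zeta_pow_self by blast
qed (simp add: zeta_def rat_imp_algebraic)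

lemma aut_root_of_unity:
  assumes "g \<in> Aut_Qbar" "z ^ m = 1" "m > 0"
  shows "g z ^ m = 1"
  using aut_power[OF assms(1) roots_of_unity_algebraic[OF assms(2,3)], of m] assms aut_1 by metis

lemma aut_root_of_unity_power:
  assumes "g \<in> Aut_Qbar" "m > 0"
  obtains a where "\<And>z. z ^ m = 1 \<Longrightarrow> g z = z ^ a"
proof -
  have z: "zeta m ^ m = 1" using zeta_pow_self assms by blast
  obtain a where a: "g (zeta m) = zeta m ^ a"
    using root_unity_is_zeta_power[OF assms(2) aut_root_of_unity[OF assms(1) z assms(2)]] by metis
  have "g y = y ^ a" if y: "y ^ m = 1" for y
  proof -
    obtain j where "y = zeta m ^ j" using root_unity_is_zeta_power[OF assms(2) y] by blast
    then show ?thesis using a 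
      by (simp add: aut_power[OF assms(1) algebraic_zeta] power_mult[symmetric] mult.commute)
  qed
  then show ?thesis using that by blast
qed

text \<open>On the \<open>m\<close>-th roots of unity both maps raise to a fixed power, and such
  maps commute.\<close>

lemma aut_commute_root_of_unity:
  assumes "g \<in> Aut_Qbar" "h \<in> Aut_Qbar" "m > 0" "z ^ m = 1"
  shows "g (h z) = h (g z)"
proof -
  obtain a where a: "\<forall>z. z ^ m = 1 \<longrightarrow> g z = z ^ a"
    by (rule aut_root_of_unity_power[OF assms(1,3)]) blast
  obtain b where b: "\<forall>z. z ^ m = 1 \<longrightarrow> h z = z ^ b"
    by (rule aut_root_of_unity_power[OF assms(2,3)]) blast
  have "(z ^ n) ^ m = 1" for n using assms(4) by (metis power_mult mult.commute power_one)
  then show ?thesis using a b assms(4) by (simp add: power_mult[symmetric] mult.commute)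
qed

section \<open>Conjugacy of roots of unity\<close>

text \<open>Coefficients are integers because both the factorisation into primes and the reduction
  modulo a prime number take place in the ring of integer polynomials.\<close>

definition ieval :: "int poly \<Rightarrow> complex \<Rightarrow> complex" where
  "ieval p z = poly (map_poly of_int p) z"

lemma ieval_0 [simp]: "ieval 0 z = 0"
  and ieval_1 [simp]: "ieval 1 z = 1"
  by (simp_all add: ieval_def)

lemma ieval_pCons [simp]: "ieval (pCons c p) z = of_int c + z * ieval p z"
  by (simp add: ieval_def map_poly_pCons)

lemma ieval_add [simp]: "ieval (p + q) z = ieval p z + ieval q z"
proof -
  have "map_poly of_int (p + q) = (map_poly of_int p + map_poly of_int q :: complex poly)"
    by (rule poly_eqI) (simp add: coeff_map_poly)
  then show ?thesis by (simp add: ieval_def)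
qed

lemma ieval_smult [simp]: "ieval (smult c q) z = of_int c * ieval q z"
proof -
  have "map_poly of_int (smult c q) = smult (of_int c) (map_poly of_int q :: complex poly)"
    by (rule poly_eqI) (simp add: coeff_map_poly)
  then show ?thesis by (simp add: ieval_def)
qed

lemma ieval_mult [simp]: "ieval (p * q) z = ieval p z * ieval q z"
  by (induction p) (simp_all add: algebra_simps)

lemma ieval_diff [simp]: "ieval (p - q) z = ieval p z - ieval q z"
  using ieval_add[of "p - q" q z] by simp

lemma ieval_power [simp]: "ieval (p ^ n) z = ieval p z ^ n"
  by (induction n) simp_all

lemma ieval_monom [simp]: "ieval (monom c n) z = of_int c * z ^ n"
  by (induction n) (simp_all add: monom_Suc monom_0)

lemma ieval_pcompose [simp]: "ieval (pcompose p q) z = ieval p (ieval q z)"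
  by (induction p) (simp_all add: pcompose_pCons)

lemma rational_poly_to_int:
  assumes "\<And>i. coeff p i \<in> \<rat>"
  obtains c :: nat and q where "c > 0" "\<And>z. ieval q z = of_nat c * poly p z"
proof -
  have "\<exists>c>0. \<exists>q. \<forall>z. ieval q z = of_nat c * poly p z"
    using assms
  proof (induction p)
    case 0
    show ?case by (rule exI[of _ 1]) (auto intro: exI[of _ 0])
  next
    case (pCons a p)
    have "a \<in> \<rat>" and p: "coeff p i \<in> \<rat>" for i
      using pCons.prems[of 0] pCons.prems[of "Suc i"] by simp_all
    from this(1) obtain u v where uv: "a = of_int u / of_int v" "v > 0" by (auto elim: Rats_cases')
    obtain c q where cq: "c > 0" "\<And>z. ieval q z = of_nat c * poly p z"
      using pCons.IH[OF p] by blast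
    have "ieval (pCons (int c * u) (smult v q)) z = of_nat (c * nat v) * poly (pCons a p) z" for z
      using uv by (simp add: cq(2) field_simps)
    moreover have "c * nat v > 0" using cq(1) uv(2) by simp
    ultimately show ?case by blast
  qed
  then show ?thesis using that by blast
qed

text \<open>Induction along the prime factorisation: a unit has no zero, and a product vanishes only
  where a factor does.\<close>

lemma prime_factor_vanishing:
  assumes "p \<noteq> 0" "ieval p z = 0"
  obtains f where "prime_elem f" "f dvd p" "ieval f z = 0"
proof -
  have "p \<noteq> 0 \<longrightarrow> ieval p z = 0 \<longrightarrow> (\<exists>f. prime_elem f \<and> f dvd p \<and> ieval f z = 0)"
  proof (induction p rule: prime_divisors_induct)
    case (unit x)
    then obtain y where "x * y = 1" by (metis dvdE)
    then have "ieval x z * ieval y z = 1" by (metis ieval_mult ieval_1)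
    then show ?case by auto
  next
    case (factor q x)
    then show ?case by (auto intro: dvd_mult2 dvd_mult)
  qed simp
  then show ?thesis using assms that by blast
qed

text \<open>A form of Gauss's lemma. Pseudo-division by a vanishing \<open>m\<close> of least degree
  turns a nonzero constant multiple of any vanishing polynomial into a multiple of \<open>m\<close>.
  For \<open>f\<close> this gives \<open>f dvd m\<close>, for \<open>r\<close> it gives
  \<open>f dvd [:c:] * r\<close>, and the constant cannot absorb \<open>f\<close>.\<close>

lemma prime_elem_dvd_vanishing:
  assumes f: "prime_elem f" "ieval f z = 0" and r: "ieval r z = 0"
  shows "f dvd r"
proof -
  have f0: "f \<noteq> 0" using f by auto
  let ?A = "\<lambda>p. p \<noteq> 0 \<and> ieval p z = 0"
  obtain m where m: "m \<noteq> 0" "ieval m z = 0" and min: "\<And>p. ?A p \<Longrightarrow> degree m \<le> degree p"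
    using ex_has_least_nat[of ?A f degree] f f0 by blast
  have const: "p = 0" if "degree p = 0" "ieval p z = 0" for p
    using that by (auto elim!: degree_eq_zeroE)
  have div: "\<exists>c s. c \<noteq> 0 \<and> smult c p = m * s" if "ieval p z = 0" for p
  proof -
    obtain c s where cs: "c \<noteq> 0" "smult c p = m * s + pseudo_mod p m"
      using pseudo_mod(1)[OF m(1), of p] by blast
    have "ieval (smult c p) z = ieval (m * s + pseudo_mod p m) z" using cs(2) by simp
    then have "ieval (pseudo_mod p m) z = 0" using m(2) that by simp
    then have "pseudo_mod p m = 0" using min pseudo_mod(2)[OF m(1), of p] by force
    then show ?thesis using cs by auto
  qed
  have "f dvd m"
  proof -
    obtain c s where cs: "c \<noteq> 0" "smult c f = m * s" using div f(2) by blast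
    then have "f dvd m * s" by (metis dvd_refl dvd_smult)
    then have "f dvd m \<or> f dvd s" using f(1) by (simp add: prime_elem_dvd_mult_iff)
    \<comment> \<open>Cancelling \<open>f\<close> would exhibit a nonzero constant as a multiple of
      \<open>m\<close>, which vanishes at \<open>z\<close>.\<close>
    moreover have False if "f dvd s"
    proof -
      obtain s' where "s = f * s'" using \<open>f dvd s\<close> by (elim dvdE)
      then have "f * [:c:] = f * (m * s')" using cs(2) by (simp add: mult_ac)
      then have "[:c:] = m * s'" unfolding mult_left_cancel[OF f0] .
      then have "ieval [:c:] z = ieval m z * ieval s' z" by (metis ieval_mult)
      then show False using m(2) cs(1) by simp
    qed
    ultimately show ?thesis by blast
  qed
  obtain c s where cs: "c \<noteq> 0" "smult c r = m * s" using div r by blast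
  then have "f dvd [:c:] * r" using \<open>f dvd m\<close> by (simp add: dvd_mult2)
  moreover have "\<not> f dvd [:c:]"
  proof
    assume "f dvd [:c:]"
    then obtain s where "[:c:] = f * s" by (elim dvdE)
    then have "ieval [:c:] z = ieval f z * ieval s z" by (metis ieval_mult)
    then show False using f(2) cs(1) by simp
  qed
  ultimately show ?thesis using prime_elem_dvd_mult_iff[OF f(1)] by metis
qed

section \<open>The Frobenius map on integer polynomials\<close>

lemma frobenius_add:
  fixes a b :: "'a :: comm_ring_1"
  assumes p: "Factorial_Ring.prime p"
  shows "of_nat p dvd (a + b) ^ p - (a ^ p + b ^ p)"
proof -
  have p0: "p > 0" using p prime_gt_0_nat by blast
  have "(a + b) ^ p = (\<Sum>k\<in>insert 0 (insert p {1..<p}). of_nat (p choose k) * a ^ k * b ^ (p - k))"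
    unfolding binomial_ring using p0 by (intro sum.cong) auto
  also have "\<dots> = b ^ p + (a ^ p + (\<Sum>k=1..<p. of_nat (p choose k) * a ^ k * b ^ (p - k)))"
    using p0 by simp
  finally have "(a + b) ^ p - (a ^ p + b ^ p) = (\<Sum>k=1..<p. of_nat (p choose k) * a ^ k * b ^ (p - k))"
    by simp
  also have "of_nat p dvd \<dots>"
  proof (intro dvd_sum dvd_mult2)
    fix k assume "k \<in> {1..<p}"
    then have "p dvd (p choose k)" using p by (intro dvd_choose_prime) auto
    then show "of_nat p dvd (of_nat (p choose k) :: 'a)" by (metis dvd_def of_nat_mult)
  qed
  finally show ?thesis .
qed

text \<open>Modulo \<open>p\<close>, raising to the power \<open>p\<close> is additive and, by
  Fermat, fixes the coefficients.\<close>

lemma poly_frobenius: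
  fixes g :: "int poly"
  assumes p: "Factorial_Ring.prime p"
  shows "of_nat p dvd g ^ p - pcompose g (monom 1 p)"
proof (induction g)
  case 0
  have "p > 0" using p prime_gt_0_nat by blast
  then show ?case by (simp add: power_0_left)
next
  case (pCons c g)
  have "[c ^ p = c] (mod int p)"
  proof -
    \<comment> \<open>Fermat's theorem is stated for natural numbers, so \<open>c\<close> is
      replaced by its residue.\<close>
    define d where "d = nat (c mod int p)"
    have d: "[c = int d] (mod int p)" using p prime_gt_0_nat by (simp add: d_def cong_def)
    have "[d ^ p = d] (mod p)"
    proof (cases "p dvd d")
      case True
      then show ?thesis using p prime_gt_0_nat
        by (metis cong_0_iff cong_sym cong_trans dvd_power dvd_trans)
    next
      case False
      then have "[d ^ (p - 1) * d = 1 * d] (mod p)"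
        using fermat_theorem[OF p] by (intro cong_mult) auto
      then show ?thesis using p prime_gt_0_nat by (metis One_nat_def Suc_pred mult_1 power_Suc2)
    qed
    then have "[int d ^ p = int d] (mod int p)" by (metis cong_int_iff of_nat_power)
    then show ?thesis using d by (meson cong_pow cong_sym cong_trans)
  qed
  then have "int p dvd c ^ p - c" by (simp add: cong_iff_dvd_diff)
  then have c: "of_nat p dvd [:c:] ^ p - [:c:]"
    by (simp add: of_nat_poly poly_const_pow diff_pCons)
  have 1: "of_nat p dvd ([:c:] + monom 1 1 * g) ^ p - ([:c:] ^ p + (monom 1 1 * g) ^ p)"
    by (rule frobenius_add[OF p])
  have 2: "of_nat p dvd monom 1 p * (g ^ p - pcompose g (monom 1 p))"
    using pCons.IH by (rule dvd_mult)
  have eq: "pCons c g = [:c:] + monom 1 1 * g" by (simp add: monom_altdef)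
  have vp: "(monom 1 1 * g) ^ p = monom 1 p * g ^ p"
    by (simp add: power_mult_distrib monom_power)
  have pc: "pcompose (pCons c g) (monom 1 p) = [:c:] + monom 1 p * pcompose g (monom 1 p)"
    by (simp add: pcompose_pCons)
  \<comment> \<open>The difference is split into three multiples of \<open>p\<close>: the additivity
    defect of the \<open>p\<close>-th power, the Fermat difference \<open>[:c:] ^ p - [:c:]\<close>,
    and the induction hypothesis times \<open>monom 1 p\<close>.\<close>
  have gen: "w - (u + m * q) = (w - (a + m * x)) + (a - u) + m * (x - q)" for w u m q a x :: "int poly"
    by (simp add: algebra_simps)
  show ?case using dvd_add[OF dvd_add[OF 1 c] 2] unfolding vp gen[symmetric] pc unfolding eq .
qed

text \<open>A polynomial with unit leading coefficient keeps its positive degree modulo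
  \<open>p\<close>, so it cannot divide a nonzero constant there.\<close>

lemma no_monic_dvd_mod_prime:
  fixes f A D :: "int poly"
  assumes p: "Factorial_Ring.prime p" and f: "is_unit (lead_coeff f)" "degree f > 0"
    and eq: "f * A = [:c:] - of_nat p * D" 
  shows "int p dvd c"
proof (rule ccontr)
  assume c: "\<not> int p dvd c"
  \<comment> \<open>After reduction to residues a nonzero leading coefficient of \<open>A1\<close>
    lies strictly between 0 and \<open>p\<close>, hence is not divisible by
    \<open>p\<close>.\<close>
  define A1 where "A1 = map_poly (\<lambda>x. x mod int p) A"
  have cA1: "coeff A1 i = coeff A i mod int p" for i by (simp add: A1_def coeff_map_poly)
  have "of_nat p dvd A - A1"
    unfolding of_nat_poly const_poly_dvd_iff by (simp add: cA1 mod_eq_dvd_iff[symmetric])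
  then obtain A2 where "A - A1 = of_nat p * A2" by (elim dvdE)
  then have A: "A = A1 + of_nat p * A2" by (simp add: algebra_simps)
  have eq1: "f * A1 = [:c:] - of_nat p * (D + f * A2)"
    using eq unfolding A by (simp add: algebra_simps)
  show False
  proof (cases "A1 = 0")
    case True
    then have "[:c:] = of_nat p * (D + f * A2)" using eq1 by simp
    then have "coeff [:c:] 0 = coeff (of_nat p * (D + f * A2)) 0" by simp
    then show False using c by (simp add: of_nat_poly)
  next
    case False
    have "f \<noteq> 0" using f by auto
    define d where "d = degree (f * A1)"
    have d: "d > 0" using f(2) False \<open>f \<noteq> 0\<close> by (simp add: d_def degree_mult_eq)
    have "lead_coeff f * lead_coeff A1 = coeff (f * A1) d" by (simp add: d_def lead_coeff_mult)
    also have "\<dots> = - int p * coeff (D + f * A2) d"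
      using d unfolding eq1 by (cases d) (simp_all add: of_nat_poly)
    finally have "int p dvd lead_coeff f * lead_coeff A1" by simp
    then have "int p dvd lead_coeff A1" using f(1) by (metis dvd_mult_unit_iff')
    moreover have "lead_coeff A1 \<noteq> 0" using False by simp
    moreover have "0 \<le> lead_coeff A1" "lead_coeff A1 < int p"
      using p prime_gt_0_nat by (simp_all add: cA1)
    ultimately show False using zdvd_imp_le by fastforce
  qed
qed

text \<open>
  If \<open>x ^ n - 1 = f * g\<close> with \<open>f\<close> irreducible vanishing at \<open>z\<close> and \<open>g\<close> at \<open>z ^ p\<close>, then \<open>f\<close> divides
  \<open>g ^ p\<close> modulo \<open>p\<close>, whereas differentiation shows that \<open>n\<close> lies in the ideal generated by
  \<open>f\<close> and \<open>g\<close>.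
\<close>

lemma root_of_unity_prime_power_conjugate:
  assumes p: "Factorial_Ring.prime p" and n: "n > 0" "\<not> p dvd n" and z: "z ^ n = 1"
  obtains g where "g \<in> Aut_Qbar" "g z = z ^ p"
proof -
  define P :: "int poly" where "P = monom 1 n - 1"
  have P0: "P \<noteq> 0" using n(1) by (simp add: P_def monom_eq_1_iff)
  have "ieval P z = 0" using z by (simp add: P_def)
  then obtain f where f: "prime_elem f" "f dvd P" "ieval f z = 0"
    using prime_factor_vanishing[OF P0] by metis
  obtain g where g: "P = f * g" using f(2) by (elim dvdE)
  have f0: "f \<noteq> 0" and g0: "g \<noteq> 0" using P0 g by auto
  have "ieval f (z ^ p) = 0"
  proof (rule ccontr)
    assume nz: "ieval f (z ^ p) \<noteq> 0"
    have "ieval P (z ^ p) = 0" using z by (simp add: P_def power_mult[symmetric])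
       (metis mult.commute power_mult power_one)
    then have "ieval g (z ^ p) = 0" using nz g by simp
    then have "ieval (pcompose g (monom 1 p)) z = 0" by simp
    then have "f dvd pcompose g (monom 1 p)" by (rule prime_elem_dvd_vanishing[OF f(1,3)])
    then obtain h where h: "pcompose g (monom 1 p) = f * h" by (elim dvdE)
    obtain r where r: "g ^ p - pcompose g (monom 1 p) = of_nat p * r"
      using poly_frobenius[OF p, of g] by (elim dvdE)
    have gp: "g ^ p = f * h + of_nat p * r" using h r by (simp add: algebra_simps)
    let ?X = "monom 1 1 :: int poly"
    have der: "of_nat n * monom 1 (n - 1) = pderiv f * g + f * pderiv g"
    proof -
      have "pderiv P = of_nat n * monom 1 (n - 1)"
        by (simp add: P_def pderiv_diff pderiv_monom of_nat_poly smult_monom)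
      then show ?thesis unfolding g by (simp add: pderiv_mult algebra_simps)
    qed
    \<comment> \<open>For \<open>P = X ^ n - 1\<close> this is the identity
      \<open>n = X * P' - n * P\<close>, rewritten with \<open>P = f * g\<close>.\<close>
    have "of_nat n = of_nat n * (P + 1) - of_nat n * P" by (simp add: algebra_simps)
    also have "P + 1 = ?X * monom 1 (n - 1)" using n(1) by (simp add: P_def mult_monom)
    also have "of_nat n * (?X * monom 1 (n - 1)) = ?X * (of_nat n * monom 1 (n - 1))" by (simp add: mult_ac)
    also have "\<dots> - of_nat n * P = (?X * pderiv f) * g + f * (?X * pderiv g - of_nat n * g)"
      unfolding der g by (simp add: algebra_simps)
    finally have bez: "of_nat n = (?X * pderiv f) * g + f * (?X * pderiv g - of_nat n * g)" .
    \<comment> \<open>Only \<open>g ^ p\<close> is known to be a multiple of \<open>f\<close> modulo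
      \<open>p\<close>, so the identity is raised to the power \<open>p\<close>.\<close>
    have "f dvd (of_nat n) ^ p - ((?X * pderiv f) * g) ^ p"
    proof -
      have "f dvd of_nat n - (?X * pderiv f) * g" by (subst bez) simp
      moreover have "of_nat n - (?X * pderiv f) * g dvd (of_nat n) ^ p - ((?X * pderiv f) * g) ^ p"
        by (metis dvd_triv_left power_diff_sumr2)
      ultimately show ?thesis by (rule dvd_trans)
    qed
    then obtain k where k: "(of_nat n) ^ p - ((?X * pderiv f) * g) ^ p = f * k" by (elim dvdE)
    define B where "B = (?X * pderiv f) ^ p"
    have "(of_nat n) ^ p = f * k + B * (f * h + of_nat p * r)"
      using k gp by (simp add: B_def power_mult_distrib algebra_simps)
    then have "f * (k + B * h) = [:int n ^ p:] - of_nat p * (B * r)"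
      by (simp add: algebra_simps of_nat_poly poly_const_pow)
    moreover have "is_unit (lead_coeff f)"
    proof -
      have "lead_coeff P = 1"
      proof -
        have "degree P = n" unfolding P_def using n(1)
          by (subst diff_conv_add_uminus, subst degree_add_eq_left) (simp_all add: degree_monom_eq)
        then show ?thesis using n(1) by (simp add: P_def)
      qed
      then have "lead_coeff f * lead_coeff g = 1" using g by (simp add: lead_coeff_mult)
      then show ?thesis by (metis dvd_triv_left)
    qed
    moreover have "degree f > 0"
    proof (rule ccontr)
      assume "\<not> degree f > 0"
      then obtain c where "f = [:c:]" by (auto elim: degree_eq_zeroE)
      then show False using f(3) f0 by simp
    qed
    ultimately have "int p dvd int n ^ p" using no_monic_dvd_mod_prime[OF p] by blast
    then have "p dvd n" using p by (metis of_nat_dvd_iff of_nat_power prime_dvd_power)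
    then show False using n(2) by simp
  qed
  then have vanish: "poly q (z ^ p) = 0" if q: "\<And>i. coeff q i \<in> \<rat>" "poly q z = 0" for q
  proof -
    obtain c r where cr: "c > 0" "\<And>y. ieval r y = of_nat c * poly q y"
      using rational_poly_to_int[OF q(1)] by metis
    then have "f dvd r" using q(2) by (intro prime_elem_dvd_vanishing[OF f(1,3)]) simp
    then obtain s where "r = f * s" by (elim dvdE)
    then have "ieval r (z ^ p) = 0" using \<open>ieval f (z ^ p) = 0\<close> by simp
    then show ?thesis using cr by simp
  qed
  have "algebraic z" using roots_of_unity_algebraic z n(1) by blast
  then show ?thesis by (rule conjugate_aut[OF _ vanish]) (assumption | rule that)+
qed

text \<open>The automorphisms belonging to the prime factors of \<open>a\<close>, none of which
  divides \<open>n\<close>, are composed.\<close>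

theorem cyclotomic_aut:
  assumes "n > 0" "coprime a n" "a > 0"
  obtains g where "g \<in> Aut_Qbar" "g (zeta n) = zeta n ^ a"
proof -
  have "\<exists>g\<in>Aut_Qbar. g (zeta n) = zeta n ^ a"
    using assms(2,3)
  proof (induction a rule: less_induct)
    case (less a)
    show ?case
    proof (cases "a = 1")
      case True
      then show ?thesis using aut_id by auto
    next
      case False
      then obtain p where p: "Factorial_Ring.prime p" "p dvd a" using prime_factor_nat by blast
      then obtain b where b: "a = p * b" by (elim dvdE)
      have "b > 0" "b < a" "coprime b n" "coprime p n"
        using less.prems b prime_gt_1_nat[OF p(1)] by auto
      then obtain g where g: "g \<in> Aut_Qbar" "g (zeta n) = zeta n ^ b" using less.IH by blast
      have "\<not> p dvd n" using \<open>coprime p n\<close> p(1) by (metis coprime_absorb_left not_prime_unit)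
      then obtain h where h: "h \<in> Aut_Qbar" "h (zeta n) = zeta n ^ p"
        using root_of_unity_prime_power_conjugate[OF p(1) assms(1) _ zeta_pow_self[OF assms(1)]] by metis
      have "(h \<circ> g) (zeta n) = zeta n ^ a"
        using g(2) h b aut_power[OF h(1) algebraic_zeta] by (simp add: power_mult)
      then show ?thesis using aut_comp[OF h(1) g(1)] by blast
    qed
  qed
  then show ?thesis using that by blast
qed

section \<open>Galois groups of stable subfields\<close>

lemma Rats_subset_subfield:
  assumes "subfield M CC" shows "\<rat> \<subseteq> M"
proof
  note sr = subfieldE(1)[OF assms]
  have add: "x + y \<in> M" and mult: "x * y \<in> M" if "x \<in> M" "y \<in> M" for x y
    using subringE(6,7)[OF sr] that by simp_all
  have minus: "- x \<in> M" if "x \<in> M" for x using subringE(5)[OF sr] that by simp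
  have zero: "0 \<in> M" and one: "1 \<in> M" using subringE(2,3)[OF sr] by simp_all
  have inv: "inverse x \<in> M" if "x \<in> M" for x
    using ring.subfield_m_inv(1)[OF ring_CC assms, of x] that zero by (cases "x = 0") auto
  have nat: "of_nat n \<in> M" for n by (induction n) (simp_all add: zero one add)
  have int: "of_int i \<in> M" for i
    by (cases i rule: int_cases2) (simp_all add: nat minus)
  fix q :: complex assume "q \<in> \<rat>"
  then obtain a b where "q = of_int a / of_int b" by (auto elim: Rats_cases')
  then show "q \<in> M" by (simp add: divide_inverse mult int inv)
qed

lemma mem_galois_group_iff:
  "\<sigma> \<in> carrier (galois_group L K) \<longleftrightarrow> \<sigma> \<in> extensional L \<and> bij_betw \<sigma> L L \<and>
     (\<forall>x\<in>L. \<forall>y\<in>L. \<sigma> (x + y) = \<sigma> x + \<sigma> y \<and> \<sigma> (x * y) = \<sigma> x * \<sigma> y) \<and> \<sigma> 1 = 1 \<and> (\<forall>x\<in>K. \<sigma> x = x)"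
  unfolding galois_group_def BijGroup_def Bij_def ring_hom_def
  by (auto dest: bij_betwE)

text \<open>These are the normal extensions of the rationals within the algebraic numbers, of finite
  or infinite degree; normality is expressed as invariance under \<open>Aut_Qbar\<close>.\<close>

definition stable :: "complex set \<Rightarrow> bool" where
  "stable M \<longleftrightarrow> subfield M CC \<and> (\<forall>x\<in>M. algebraic x) \<and> (\<forall>g\<in>Aut_Qbar. g ` M \<subseteq> M)"

text \<open>The graph of \<sigma> is a partial homomorphism and so extends to a member of
  \<open>Aut_Qbar\<close>. Conversely, \<open>g\<close> maps \<open>M\<close> onto itself because
  its inverse maps \<open>M\<close> into itself too.\<close>

lemma carrier_galois_group_stable:
  assumes "stable M"
  shows "carrier (galois_group M \<rat>) = (\<lambda>g. restrict g M) ` Aut_Qbar"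
proof (intro equalityI subsetI)
  have M: "subfield M CC" "\<And>x. x \<in> M \<Longrightarrow> algebraic x"
    and st: "\<And>g x. g \<in> Aut_Qbar \<Longrightarrow> x \<in> M \<Longrightarrow> g x \<in> M"
    using assms by (auto simp: stable_def)
  note sr = subfieldE(1)[OF M(1)]
  have add: "x + y \<in> M" and mult: "x * y \<in> M" if "x \<in> M" "y \<in> M" for x y
    using subringE(6,7)[OF sr] that by simp_all
  have one: "1 \<in> M" using subringE(3)[OF sr] by simp
  have rat: "\<rat> \<subseteq> M" by (rule Rats_subset_subfield[OF M(1)])
  fix \<sigma>
  { assume "\<sigma> \<in> carrier (galois_group M \<rat>)"
    then have \<sigma>: "\<sigma> \<in> extensional M" "\<And>x y. x \<in> M \<Longrightarrow> y \<in> M \<Longrightarrow> \<sigma> (x + y) = \<sigma> x + \<sigma> y \<and> \<sigma> (x * y) = \<sigma> x * \<sigma> y"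
      "\<And>x. x \<in> \<rat> \<Longrightarrow> \<sigma> x = x"
      by (auto simp: mem_galois_group_iff)
    have "partial_hom ((\<lambda>x. (x, \<sigma> x)) ` M)"
      unfolding partial_hom_def using \<sigma>(2,3) rat M(2) add mult
      by (auto simp: image_iff)
    then obtain g where "g \<in> Aut_Qbar" and g: "\<And>a b. (a, b) \<in> (\<lambda>x. (x, \<sigma> x)) ` M \<Longrightarrow> g a = b"
      by (rule partial_hom_extends) blast
    moreover have "\<sigma> = restrict g M"
    proof
      fix x show "\<sigma> x = restrict g M x"
        using g[of x "\<sigma> x"] \<sigma>(1) by (cases "x \<in> M") (auto simp: extensional_def)
    qed
    ultimately show "\<sigma> \<in> (\<lambda>g. restrict g M) ` Aut_Qbar" by blast
  }
  assume "\<sigma> \<in> (\<lambda>g. restrict g M) ` Aut_Qbar"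
  then obtain g where g: "g \<in> Aut_Qbar" "\<sigma> = restrict g M" by blast
  obtain h where h: "h \<in> Aut_Qbar" "\<And>x. algebraic x \<Longrightarrow> g (h x) = x"
    by (rule aut_inv[OF g(1)]) blast
  have "bij_betw g M M"
  proof (rule bij_betw_imageI)
    show "inj_on g M" using aut_eq_iff[OF g(1)] M(2) by (auto simp: inj_on_def)
    have "x \<in> g ` M" if "x \<in> M" for x
      using h(2)[OF M(2)[OF that]] st[OF h(1) that] by (metis imageI)
    then show "g ` M = M" using st[OF g(1)] by blast
  qed
  then show "\<sigma> \<in> carrier (galois_group M \<rat>)"
    unfolding mem_galois_group_iff g(2)
    using aut_add[OF g(1)] aut_mult[OF g(1)] aut_1[OF g(1)] aut_rat[OF g(1)] M(2) add mult one rat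
    by (auto simp: bij_betw_cong[of M "restrict g M" g])
qed

section \<open>Fields generated by a set of numbers, and finite Galois extensions\<close>

lemma QQ_adjoin_subfield: "subfield (QQ_adjoin S) CC"
  unfolding QQ_adjoin_def by (rule field.generate_field_is_subfield[OF field_CC]) simp

lemma QQ_adjoin_incl: "x \<in> S \<Longrightarrow> x \<in> QQ_adjoin S"
  unfolding QQ_adjoin_def by (rule generate_field.incl) simp

lemma QQ_adjoin_induct [consumes 1, case_names rat incl minus inverse add mult]:
  assumes "x \<in> QQ_adjoin S"
    and "\<And>q. q \<in> \<rat> \<Longrightarrow> P q" "\<And>x. x \<in> S \<Longrightarrow> P x" "\<And>x. x \<in> QQ_adjoin S \<Longrightarrow> P x \<Longrightarrow> P (- x)"
    "\<And>x. x \<in> QQ_adjoin S \<Longrightarrow> P x \<Longrightarrow> P (inverse x)" 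
    "\<And>x y. x \<in> QQ_adjoin S \<Longrightarrow> P x \<Longrightarrow> y \<in> QQ_adjoin S \<Longrightarrow> P y \<Longrightarrow> P (x + y)"
    "\<And>x y. x \<in> QQ_adjoin S \<Longrightarrow> P x \<Longrightarrow> y \<in> QQ_adjoin S \<Longrightarrow> P y \<Longrightarrow> P (x * y)"
  shows "P x"
  using assms(1) unfolding QQ_adjoin_def
proof (induction rule: generate_field.induct)
  case one
  show ?case using assms(2)[of 1] by simp
qed (use assms(2-) in \<open>auto simp: QQ_adjoin_def\<close>)

lemma QQ_adjoin_algebraic:
  assumes "\<And>x. x \<in> S \<Longrightarrow> algebraic x" "x \<in> QQ_adjoin S"
  shows "algebraic x"
  using assms(2)
  by (induction rule: QQ_adjoin_induct)
    (auto intro: rat_imp_algebraic algebraic_add algebraic_mult assms(1))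

lemma QQ_adjoin_closed:
  assumes "x \<in> QQ_adjoin S" "y \<in> QQ_adjoin S"
  shows "x + y \<in> QQ_adjoin S" "x * y \<in> QQ_adjoin S" "- x \<in> QQ_adjoin S" "inverse x \<in> QQ_adjoin S"
proof -
  note sr = subfieldE(1)[OF QQ_adjoin_subfield[of S]]
  show "x + y \<in> QQ_adjoin S" "x * y \<in> QQ_adjoin S" "- x \<in> QQ_adjoin S"
    using subringE(5-7)[OF sr] assms by simp_all
  show "inverse x \<in> QQ_adjoin S"
    using ring.subfield_m_inv(1)[OF ring_CC QQ_adjoin_subfield, of x S] assms(1) by (cases "x = 0") auto
qed

lemma QQ_adjoin_rat: "q \<in> \<rat> \<Longrightarrow> q \<in> QQ_adjoin S"
  using Rats_subset_subfield[OF QQ_adjoin_subfield] by blast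

lemma QQ_adjoin_mono:
  assumes "S \<subseteq> QQ_adjoin T" shows "QQ_adjoin S \<subseteq> QQ_adjoin T"
proof
  fix x assume "x \<in> QQ_adjoin S"
  then show "x \<in> QQ_adjoin T"
    by (induction rule: QQ_adjoin_induct) (use assms in \<open>auto intro: QQ_adjoin_closed QQ_adjoin_rat\<close>)
qed

lemma QQ_adjoin_fixed:
  assumes g: "g \<in> Aut_Qbar" and S: "\<And>x. x \<in> S \<Longrightarrow> algebraic x \<and> g x = x" and x: "x \<in> QQ_adjoin S"
  shows "g x = x"
  using x
proof (induction rule: QQ_adjoin_induct)
  case (rat q) then show ?case using aut_rat[OF g] by blast
qed (use S QQ_adjoin_algebraic[of S] in
    \<open>auto simp: aut_add[OF g] aut_mult[OF g] aut_minus[OF g] aut_inverse[OF g]\<close>)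

lemma stable_QQ_adjoin:
  assumes S: "\<And>x. x \<in> S \<Longrightarrow> algebraic x" and st: "\<And>g x. g \<in> Aut_Qbar \<Longrightarrow> x \<in> S \<Longrightarrow> g x \<in> QQ_adjoin S"
  shows "stable (QQ_adjoin S)"
proof -
  have "g x \<in> QQ_adjoin S" if g: "g \<in> Aut_Qbar" and "x \<in> QQ_adjoin S" for g x
    using that(2)
  proof (induction rule: QQ_adjoin_induct)
    case (rat q) then show ?case using aut_rat[OF g] QQ_adjoin_rat by simp
  qed (use st[OF g] S QQ_adjoin_algebraic[of S] in
      \<open>auto simp: aut_add[OF g] aut_mult[OF g] aut_minus[OF g] aut_inverse[OF g] QQ_adjoin_closed\<close>)
  then show ?thesis using QQ_adjoin_subfield QQ_adjoin_algebraic[OF S] by (auto simp: stable_def)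
qed

text \<open>Artin's argument: the product of \<open>[:-y, 1:]\<close> over the finite Galois orbit
  of \<open>x\<close> has invariant, hence rational, coefficients. So \<open>x\<close> is algebraic,
  and every automorphism sends it to a root, that is, into the orbit, which lies in
  \<open>F\<close>.\<close>

lemma stable_galois:
  assumes F: "subfield F CC"
    and fixd: "{x \<in> F. \<forall>\<sigma>\<in>carrier (galois_group F \<rat>). \<sigma> x = x} = \<rat>"
    and fin: "finite (carrier (galois_group F \<rat>))"
  shows "stable F"
proof -
  let ?G = "carrier (galois_group F \<rat>)"
  note sr = subfieldE(1)[OF F]
  have add: "x + y \<in> F" and mult: "x * y \<in> F" if "x \<in> F" "y \<in> F" for x y
    using subringE(6,7)[OF sr] that by simp_all
  have minus: "- x \<in> F" if "x \<in> F" for x using subringE(5)[OF sr] that by simp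
  have one: "1 \<in> F" and zero: "0 \<in> F" using subringE(2,3)[OF sr] by simp_all
  have rat: "\<rat> \<subseteq> F" by (rule Rats_subset_subfield[OF F])
  have "algebraic x \<and> (\<forall>g\<in>Aut_Qbar. g x \<in> F)" if x: "x \<in> F" for x
  proof -
    define O' where "O' = (\<lambda>\<sigma>. \<sigma> x) ` ?G"
    have finO: "finite O'" using fin by (simp add: O'_def)
    have OsF: "O' \<subseteq> F" 
    proof
      fix y assume "y \<in> O'"
      then obtain \<sigma> where "\<sigma> \<in> ?G" "y = \<sigma> x" by (auto simp: O'_def)
      then show "y \<in> F" using x bij_betwE[of \<sigma> F F] unfolding mem_galois_group_iff by blast
    qed
    have "(\<lambda>y\<in>F. y) \<in> ?G" using rat one add mult
      by (auto simp: mem_galois_group_iff bij_betw_def inj_on_def)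
    then have xO: "x \<in> O'" unfolding O'_def by (rule rev_image_eqI) (use x in simp)
    have perm: "\<tau> ` O' = O'" if \<tau>: "\<tau> \<in> ?G" for \<tau>
    proof (rule endo_inj_surj[OF finO])
      have bij: "bij_betw \<tau> F F" using \<tau> by (simp add: mem_galois_group_iff)
      show "inj_on \<tau> O'" using bij OsF by (meson bij_betw_imp_inj_on inj_on_subset)
      show "\<tau> ` O' \<subseteq> O'"
      proof clarify
        fix y assume "y \<in> O'"
        then obtain \<sigma> where \<sigma>: "\<sigma> \<in> ?G" "y = \<sigma> x" by (auto simp: O'_def)
        have bs: "bij_betw \<sigma> F F" using \<sigma> by (simp add: mem_galois_group_iff)
        have "bij_betw (restrict (\<tau> \<circ> \<sigma>) F) F F"
          using bij_betw_trans[OF bs bij] by (simp add: bij_betw_cong[of F "restrict (\<tau> \<circ> \<sigma>) F" "\<tau> \<circ> \<sigma>"])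
        then have "restrict (\<tau> \<circ> \<sigma>) F \<in> ?G"
          using \<sigma>(1) \<tau> rat one add mult bij_betwE[OF bs] by (auto simp: mem_galois_group_iff)
        moreover have "\<tau> y = restrict (\<tau> \<circ> \<sigma>) F x" using \<sigma> x by simp
        ultimately show "\<tau> y \<in> O'" unfolding O'_def
          by (intro image_eqI[of _ _ "restrict (\<tau> \<circ> \<sigma>) F"]) simp_all
      qed
    qed
    \<comment> \<open>Membership of the coefficients in \<open>F\<close> is part of the induction,
      because \<open>\<tau>\<close> respects sums and products only on \<open>F\<close>.\<close>
    have coeffs: "(\<forall>i. coeff (\<Prod>y\<in>A. [:-y, 1:]) i \<in> F) \<and>
        (\<forall>\<tau>\<in>?G. \<forall>i. \<tau> (coeff (\<Prod>y\<in>A. [:-y, 1:]) i) = coeff (\<Prod>y\<in>A. [:- \<tau> y, 1:]) i)"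
      if "finite A" "A \<subseteq> F" for A
      using that
    proof (induction A rule: finite_induct)
      case empty
      have "\<tau> 0 = 0" "\<tau> 1 = 1" if "\<tau> \<in> ?G" for \<tau>
        using that unfolding mem_galois_group_iff by (metis Rats_0, metis)
      then show ?case using zero one by (auto simp: coeff_pCons one_pCons split: nat.splits)
    next
      case (insert a A)
      let ?P = "\<Prod>y\<in>A. [:-y, 1:]"
      have IH: "coeff ?P i \<in> F" "\<tau> \<in> ?G \<Longrightarrow> \<tau> (coeff ?P i) = coeff (\<Prod>y\<in>A. [:- \<tau> y, 1:]) i" for i \<tau>
        using insert.IH insert.prems by auto
      have shift: "coeff (pCons 0 ?P) i \<in> F" for i using IH(1) zero by (cases i) auto
      have c: "coeff ([:-b, 1:] * Q) i = - b * coeff Q i + coeff (pCons 0 Q) i" for b i and Q :: "complex poly"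
        by simp
      have a: "a \<in> F" using insert.prems by simp
      have 1: "coeff ([:-a, 1:] * ?P) i \<in> F" for i
        unfolding c using a IH(1) shift by (intro add mult minus)
      have 2: "\<tau> (coeff ([:-a, 1:] * ?P) i) = coeff ([:- \<tau> a, 1:] * (\<Prod>y\<in>A. [:- \<tau> y, 1:])) i"
        if \<tau>: "\<tau> \<in> ?G" for \<tau> i
      proof -
        have hom: "\<tau> (y + z) = \<tau> y + \<tau> z" "\<tau> (y * z) = \<tau> y * \<tau> z" if "y \<in> F" "z \<in> F" for y z
          using \<tau> that by (auto simp: mem_galois_group_iff)
        have t0: "\<tau> 0 = 0" using \<tau> by (auto simp: mem_galois_group_iff)
        have "\<tau> (- a) = - \<tau> a" using hom(1)[of a "- a"] a minus t0
          by (simp add: eq_neg_iff_add_eq_0 add.commute)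
        moreover have "\<tau> (coeff (pCons 0 ?P) i) = coeff (pCons 0 (\<Prod>y\<in>A. [:- \<tau> y, 1:])) i"
          using IH(2)[OF \<tau>] t0 by (cases i) auto
        ultimately show ?thesis
          unfolding c using a IH(1) IH(2)[OF \<tau>] shift by (simp only: hom minus mult)
      qed
      show ?case unfolding prod.insert[OF insert.hyps] using 1 2 by blast
    qed
    define P where "P = (\<Prod>y\<in>O'. [:-y, 1:])"
    have "coeff P i \<in> \<rat>" for i
    proof -
      have "\<tau> (coeff P i) = coeff P i" if \<tau>: "\<tau> \<in> ?G" for \<tau>
      proof -
        have inj: "inj_on \<tau> O'" using \<tau> OsF by (auto simp: mem_galois_group_iff bij_betw_def intro: inj_on_subset)
        have "\<tau> (coeff P i) = coeff (\<Prod>y\<in>O'. [:- \<tau> y, 1:]) i"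
          using coeffs[OF finO OsF] \<tau> unfolding P_def by blast
        also have "(\<Prod>y\<in>O'. [:- \<tau> y, 1:]) = (\<Prod>y\<in>\<tau> ` O'. [:-y, 1:])"
          by (subst prod.reindex[OF inj]) simp
        finally show ?thesis by (simp add: perm[OF \<tau>] P_def)
      qed
      moreover have "coeff P i \<in> F" using coeffs[OF finO OsF] by (simp add: P_def)
      ultimately show ?thesis using fixd by blast
    qed
    moreover have root: "poly P y = 0 \<longleftrightarrow> y \<in> O'" for y
      using finO by (simp add: P_def poly_prod prod_zero_iff)
    moreover have "P \<noteq> 0" using finO by (simp add: P_def)
    ultimately have alg: "algebraic x" using xO by (auto simp: algebraic_altdef)
    have "g x \<in> F" if g: "g \<in> Aut_Qbar" for g
    proof -
      have "poly P (g x) = g (poly P x)"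
        using aut_poly_rat[OF g _ alg, of P] \<open>\<And>i. coeff P i \<in> \<rat>\<close> by simp
      moreover have "poly P x = 0" using root xO by blast
      ultimately have "poly P (g x) = 0" using aut_0[OF g] by simp
      then show ?thesis using root OsF by blast
    qed
    then show ?thesis using alg by blast
  qed
  then show ?thesis using F by (auto simp: stable_def)
qed

section \<open>Independence at a large prime\<close>

lemma funpow_scale:
  assumes u: "u \<in> Aut_Qbar" and z: "algebraic z" "u z = \<eta> * z" and \<eta>: "algebraic \<eta>" "u \<eta> = \<eta>"
  shows "(u ^^ k) z = \<eta> ^ k * z"
proof (induction k)
  case (Suc k)
  have "u (\<eta> ^ k * z) = \<eta> ^ k * (\<eta> * z)"
    using aut_mult[OF u algebraic_power[OF \<eta>(1)] z(1)] aut_power[OF u \<eta>(1)] z(2) \<eta>(2) by simp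
  then show ?case using Suc by simp
qed simp

lemma funpow_fixes: "g x = x \<Longrightarrow> (g ^^ n) x = x"
  by (induction n) simp_all

text \<open>Both \<open>z\<close> and \<open>g z\<close> are \<open>N\<close>-th roots of the same
  rational number; for \<open>z = 0\<close> the ratio is set to 1.\<close>

lemma aut_radical_ratio:
  assumes g: "g \<in> Aut_Qbar" and N: "N > 0" and z: "z ^ N \<in> \<rat>"
  obtains \<eta> where "\<eta> ^ N = 1" "g z = \<eta> * z"
proof (cases "z = 0")
  case True
  then show ?thesis using that[of 1] aut_0[OF g] by simp
next
  case False
  have "algebraic z" using z N rat_imp_algebraic algebraic_of_power by blast
  then have "g z ^ N = z ^ N" using aut_power[OF g, of z N] aut_rat[OF g z] by simp
  then have "(g z / z) ^ N = 1" using False by (simp add: power_divide)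
  then show ?thesis using that[of "g z / z"] False by simp
qed

text \<open>Pigeonhole: two of the first \<open>f + 1\<close> iterates of \<open>x\<close> under
  \<open>v\<close> coincide, so \<open>x\<close> has a period of at most \<open>f\<close>, and this
  period divides \<open>fact f\<close>.\<close>

lemma funpow_fact_fixes:
  assumes v: "v \<in> Aut_Qbar" and x: "algebraic x"
    and fin: "finite ((\<lambda>g. g x) ` Aut_Qbar)" "card ((\<lambda>g. g x) ` Aut_Qbar) \<le> f"
  shows "(v ^^ fact f) x = x"
proof -
  have inj: "(v ^^ k) y = (v ^^ k) z \<longleftrightarrow> y = z" if "algebraic y" "algebraic z" for k y z
    using aut_eq_iff[OF aut_funpow[OF v]] that by blast
  have "\<not> inj_on (\<lambda>k. (v ^^ k) x) {..f}"
  proof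
    assume "inj_on (\<lambda>k. (v ^^ k) x) {..f}"
    then have "card ((\<lambda>k. (v ^^ k) x) ` {..f}) = f + 1" by (simp add: card_image)
    moreover have "card ((\<lambda>k. (v ^^ k) x) ` {..f}) \<le> card ((\<lambda>g. g x) ` Aut_Qbar)"
      by (rule card_mono[OF fin(1)]) (auto intro: aut_funpow[OF v])
    ultimately show False using fin(2) by simp
  qed
  then obtain a b where ab: "a \<le> f" "b \<le> f" "a \<noteq> b" "(v ^^ a) x = (v ^^ b) x"
    unfolding inj_on_def by auto
  define i j where "i = min a b" and "j = max a b"
  have ij: "i < j" "j \<le> f" "(v ^^ i) x = (v ^^ j) x"
    using ab by (auto simp: i_def j_def min_def max_def)
  have "(v ^^ i) ((v ^^ (j - i)) x) = (v ^^ j) x"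
    using ij(1) funpow_add[of i "j - i" v] by simp
  then have "(v ^^ i) ((v ^^ (j - i)) x) = (v ^^ i) x" unfolding ij(3) .
  then have per: "(v ^^ (j - i)) x = x"
    using inj aut_algebraic[OF aut_funpow[OF v] x] x by blast
  have "j - i dvd fact f" using ij by (intro dvd_fact) auto
  then obtain k where "fact f = (j - i) * k" by (elim dvdE)
  then have "v ^^ fact f = (v ^^ (j - i)) ^^ k" by (simp add: funpow_mult)
  then show ?thesis using funpow_fixes[of "v ^^ (j - i)", OF per] by simp
qed

lemma cnj_root_of_unity:
  assumes "z ^ m = 1" "m > 0" shows "cnj z = inverse z"
proof -
  obtain j where "z = zeta m ^ j" using root_unity_is_zeta_power[OF assms(2,1)] by metis
  then have "z = cis (2 * pi * real j / real m)" by (simp add: zeta_power)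
  then show ?thesis by (simp add: cis_cnj)
qed

text \<open>
  Commutators act trivially on roots of unity; since complex conjugation inverts them and fixes
  the real radical \<open>\<theta>\<close>, its commutator with an automorphism moving \<open>\<theta>\<close> still moves \<open>\<theta>\<close>.
\<close>

lemma commutator_moves_radical:
  assumes l: "Factorial_Ring.prime l" "l \<noteq> 2"
    and \<theta>: "\<theta> \<in> \<real>" "\<theta> \<notin> \<rat>" "\<theta> ^ l \<in> \<rat>"
  obtains u \<kappa> where "u \<in> Aut_Qbar" "\<And>z m. m > 0 \<Longrightarrow> z ^ m = 1 \<Longrightarrow> u z = z"
    "\<kappa> ^ l = 1" "\<kappa> \<noteq> 1" "u \<theta> = \<kappa> * \<theta>"
proof -
  have l0: "l > 0" using l(1) prime_gt_0_nat by blast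
  have alg: "algebraic \<theta>" using \<theta>(3) l0 rat_imp_algebraic algebraic_of_power by blast
  have \<theta>0: "\<theta> \<noteq> 0" using \<theta>(2) by auto
  obtain g where g: "g \<in> Aut_Qbar" "g \<theta> \<noteq> \<theta>" using irrational_moved[OF alg \<theta>(2)] by metis
  obtain h where h: "h \<in> Aut_Qbar" "\<And>x. algebraic x \<Longrightarrow> g (h x) = x" by (rule aut_inv[OF g(1)]) blast
  define u where "u = g \<circ> cnj \<circ> h \<circ> cnj"
  have u: "u \<in> Aut_Qbar" unfolding u_def by (intro aut_comp aut_cnj g h)
  have unity: "u z = z" if "m > 0" "z ^ m = 1" for z m
  proof -
    have hz: "h z ^ m = 1" using aut_root_of_unity[OF h(1) that(2,1)] .
    have "u z = g (cnj (cnj (h z)))"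
      using aut_commute_root_of_unity[OF h(1) aut_cnj that] by (simp add: u_def)
    then show ?thesis using h(2)[OF roots_of_unity_algebraic[OF that(2,1)]] by simp
  qed
  obtain \<omega> where \<omega>: "\<omega> ^ l = 1" "h \<theta> = \<omega> * \<theta>" by (rule aut_radical_ratio[OF h(1) l0 \<theta>(3)])
  have alg\<omega>: "algebraic \<omega>" using roots_of_unity_algebraic[OF \<omega>(1) l0] .
  \<comment> \<open>Because \<open>g (h \<theta>) = \<theta>\<close>, this is the factor by which
    \<open>g\<close> scales \<theta>; the commutator will scale \<theta> by its square.\<close>
  define \<rho> where "\<rho> = inverse (g \<omega>)"
  have g\<omega>: "g \<omega> ^ l = 1" using aut_root_of_unity[OF g(1) \<omega>(1) l0] .
  then have g\<omega>0: "g \<omega> \<noteq> 0" using l0 by (auto simp: power_0_left)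
  have \<rho>l: "\<rho> ^ l = 1" using g\<omega> by (simp add: \<rho>_def power_inverse)
  have "g (h \<theta>) = g \<omega> * g \<theta>" using \<omega>(2) aut_mult[OF g(1) alg\<omega> alg] by simp
  then have g\<theta>: "g \<theta> = \<rho> * \<theta>" using h(2)[OF alg] g\<omega>0 by (simp add: \<rho>_def field_simps)
  have "u \<theta> = g (cnj (h \<theta>))" using \<theta>(1) by (simp add: u_def Reals_cnj_iff)
  also have "cnj (h \<theta>) = inverse \<omega> * \<theta>"
    using \<omega>(2) \<theta>(1) cnj_root_of_unity[OF \<omega>(1) l0] by (simp add: Reals_cnj_iff)
  also have "g (inverse \<omega> * \<theta>) = \<rho> * (\<rho> * \<theta>)"
    using aut_mult[OF g(1) algebraic_inverse[OF alg\<omega>] alg] aut_inverse[OF g(1) alg\<omega>] g\<theta> by (simp add: \<rho>_def)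
  finally have "u \<theta> = \<rho>\<^sup>2 * \<theta>" by (simp add: power2_eq_square)
  moreover have "(\<rho>\<^sup>2) ^ l = 1" using \<rho>l by (metis mult.commute power_mult power_one)
  \<comment> \<open>As \<open>l\<close> is odd, \<open>\<rho>\<^sup>2 = 1\<close> and
    \<open>\<rho> ^ l = 1\<close> would give \<open>\<rho> = 1\<close>, so \<open>g\<close> would
    fix \<theta>.\<close>
  moreover have "\<rho>\<^sup>2 \<noteq> 1"
  proof
    assume 2: "\<rho>\<^sup>2 = 1"
    have "odd l" using l prime_odd_nat primes_dvd_imp_eq two_is_prime_nat by blast
    then obtain k where "l = 2 * k + 1" by (elim oddE)
    then have "\<rho> ^ l = \<rho>" using 2 by (simp add: power_mult)
    then show False using \<rho>l g(2) g\<theta> by simp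
  qed
  ultimately show ?thesis using that u unity by metis
qed

text \<open>Each fibre of \<open>a \<mapsto> a ^ f\<close> modulo \<open>l\<close> has at most
  \<open>f\<close> elements, since a polynomial of degree \<open>f\<close> has at most
  \<open>f\<close> roots there.\<close>

lemma power_residues_card:
  fixes l f :: nat
  assumes l: "Factorial_Ring.prime l" and f: "f > 0"
  shows "l - 1 \<le> card ((\<lambda>a. a ^ f mod l) ` {1..<l}) * f"
proof -
  let ?D = "(\<lambda>a. a ^ f mod l) ` {1..<l}"
  have "{1..<l} = (\<Union>d\<in>?D. {a\<in>{1..<l}. a ^ f mod l = d})" by auto
  then have "l - 1 = card (\<Union>d\<in>?D. {a\<in>{1..<l}. a ^ f mod l = d})" by (metis card_atLeastLessThan)
  also have "\<dots> \<le> (\<Sum>d\<in>?D. card {a\<in>{1..<l}. a ^ f mod l = d})" by (rule card_UN_le) simp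
  also have "\<dots> \<le> (\<Sum>d\<in>?D. f)"
  proof (rule sum_mono)
    fix d assume "d \<in> ?D"
    have "card {a\<in>{1..<l}. a ^ f mod l = d} \<le> card {x\<in>{..<l}. [x ^ f = d] (mod l)}"
      by (rule card_mono) (auto simp: cong_def)
    also have "\<dots> \<le> f" by (rule roots_mod_prime_bound[OF l f])
    finally show "card {a\<in>{1..<l}. a ^ f mod l = d} \<le> f" .
  qed
  finally show ?thesis by simp
qed

section \<open>Conjugates of \<open>zeta l\<close> and of a real radical over \<open>F\<close> and
  the \<open>N\<close>-th radicals\<close>

context
  fixes F :: "complex set" and f N l :: nat and \<theta> :: complex
  assumes F: "\<And>x. x \<in> F \<Longrightarrow> algebraic x"
    and orbit: "\<And>x. x \<in> F \<Longrightarrow> finite ((\<lambda>g. g x) ` Aut_Qbar) \<and> card ((\<lambda>g. g x) ` Aut_Qbar) \<le> f"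
    and N: "N > 0" and l: "Factorial_Ring.prime l" "l \<noteq> 2" "\<not> l dvd N" "l > f"
    and \<theta>: "\<theta> \<in> \<real>" "\<theta> \<notin> \<rat>" "\<theta> ^ l \<in> \<rat>"
begin

lemma l_pos: "l > 0" using l(1) prime_gt_0_nat by blast

text \<open>The exponent \<open>N * fact f\<close> makes the power of the commutator trivial on
  \<open>F\<close> and on the \<open>N\<close>-th radicals. It still moves \<theta>, since
  \<open>l\<close> divides neither \<open>N\<close> nor \<open>fact f\<close>.\<close>

lemma radical_translation:
  obtains U \<kappa> where "U \<in> Aut_Qbar" "\<And>x. x \<in> F \<Longrightarrow> U x = x" "\<And>z. z ^ N \<in> \<rat> \<Longrightarrow> U z = z"
    "U (zeta l) = zeta l" "\<kappa> ^ l = 1" "\<kappa> \<noteq> 1" "U \<theta> = \<kappa> * \<theta>" "U \<kappa> = \<kappa>"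
proof -
  obtain u \<kappa> where u: "u \<in> Aut_Qbar" "\<And>z m. m > 0 \<Longrightarrow> z ^ m = 1 \<Longrightarrow> u z = z"
    and \<kappa>: "\<kappa> ^ l = 1" "\<kappa> \<noteq> 1" "u \<theta> = \<kappa> * \<theta>"
    by (rule commutator_moves_radical[OF l(1,2) \<theta>]) blast
  define U where "U = u ^^ (N * fact f)"
  have U: "U \<in> Aut_Qbar" unfolding U_def by (rule aut_funpow[OF u(1)])
  have alg: "algebraic \<theta>" using \<theta>(3) l_pos rat_imp_algebraic algebraic_of_power by blast
  have "U x = x" if "x \<in> F" for x
  proof -
    have "((u ^^ N) ^^ fact f) x = x"
      using orbit[OF that] by (intro funpow_fact_fixes aut_funpow u F that) auto
    then show ?thesis by (simp add: U_def funpow_mult)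
  qed
  moreover have "U z = z" if z: "z ^ N \<in> \<rat>" for z
  proof -
    have az: "algebraic z" using z N rat_imp_algebraic algebraic_of_power by blast
    obtain \<eta> where \<eta>: "\<eta> ^ N = 1" "u z = \<eta> * z" by (rule aut_radical_ratio[OF u(1) N z])
    have "U z = \<eta> ^ (N * fact f) * z" unfolding U_def
      using funpow_scale[OF u(1) az \<eta>(2) roots_of_unity_algebraic[OF \<eta>(1) N] u(2)[OF N \<eta>(1)]] .
    then show ?thesis using \<eta>(1) by (simp add: power_mult)
  qed
  moreover have root: "U z = z" if "z ^ l = 1" for z
    unfolding U_def using u(2)[OF l_pos that] by (rule funpow_fixes)
  moreover have "U (zeta l) = zeta l" using root zeta_pow_self[OF l_pos] by blast
  moreover have "U \<theta> = \<kappa> ^ (N * fact f) * \<theta>" unfolding U_def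
      using funpow_scale[OF u(1) alg \<kappa>(3) roots_of_unity_algebraic[OF \<kappa>(1) l_pos] u(2)[OF l_pos \<kappa>(1)]] .
  moreover have \<kappa>l: "(\<kappa> ^ (N * fact f)) ^ l = 1" using \<kappa>(1) by (metis mult.commute power_mult power_one)
  moreover have "\<kappa> ^ (N * fact f) \<noteq> 1"
  proof
    assume 1: "\<kappa> ^ (N * fact f) = 1"
    obtain j where j: "\<kappa> = zeta l ^ j" using root_unity_is_zeta_power[OF l_pos \<kappa>(1)] by metis
    have "zeta l ^ (j * (N * fact f)) = zeta l ^ 0" using 1 j by (simp add: power_mult)
    then have "l dvd j * (N * fact f)" unfolding zeta_power_eq_iff[OF l_pos] by (simp add: cong_0_iff)
    moreover have "\<not> l dvd fact f" using l(1,4) by (simp add: prime_dvd_fact_iff)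
    ultimately have "l dvd j" using l(1,3) by (simp add: prime_dvd_mult_iff)
    then have "zeta l ^ j = zeta l ^ 0" unfolding zeta_power_eq_iff[OF l_pos] by (simp add: cong_0_iff)
    then show False using j \<kappa>(2) by simp
  qed
  ultimately show ?thesis using that U by metis
qed

text \<open>
  For \<open>v\<close> fixing the \<open>N\<close>-th roots of unity and \<open>c\<close> complex conjugation, \<open>v c v c\<close> fixes all radicals \<open>z\<close>
  with \<open>z ^ N \<in> \<rat>\<close>, while it acts on \<open>zeta l\<close> by the square of the action of \<open>v\<close>.
\<close>

lemma cyclotomic_translation:
  assumes a: "coprime a l"
  obtains y where "y \<in> Aut_Qbar" "\<And>x. x \<in> F \<Longrightarrow> y x = x" "\<And>z. z ^ N \<in> \<rat> \<Longrightarrow> y z = z"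
    "y (zeta l) = zeta l ^ (a ^ (2 * fact f))"
proof -
  have cop: "coprime N l" using l(1,3) by (metis coprime_commute prime_imp_coprime)
  obtain b0 where b0: "[b0 = 1] (mod N)" "[b0 = a] (mod l)"
    using binary_chinese_remainder_nat[OF cop] by metis
  \<comment> \<open>Adding \<open>N * l\<close> keeps both congruences and makes the exponent
    positive, as \<open>cyclotomic_aut\<close> requires.\<close>
  define b where "b = b0 + N * l"
  have b: "[b = 1] (mod N)" "[b = a] (mod l)" "b > 0"
    using b0 N l_pos by (auto simp: b_def cong_def)
  have "coprime b N" using b(1) by (metis cong_imp_coprime cong_sym coprime_1_left)
  moreover have "coprime b l" using b(2) a by (metis cong_imp_coprime cong_sym)
  ultimately have cb: "coprime b (N * l)" by simp
  have Nl: "N * l > 0" using N l_pos by simp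
  obtain v where v: "v \<in> Aut_Qbar" "v (zeta (N * l)) = zeta (N * l) ^ b"
    by (rule cyclotomic_aut[OF Nl cb b(3)])
  have vroot: "v z = z ^ b" if z: "z ^ (N * l) = 1" for z
  proof -
    obtain j where j: "z = zeta (N * l) ^ j" using root_unity_is_zeta_power[OF Nl z] by metis
    then show ?thesis using v(2) aut_power[OF v(1) algebraic_zeta]
      by (simp add: power_mult[symmetric] mult.commute)
  qed
  define \<xi> where "\<xi> = zeta l"
  have \<xi>: "\<xi> ^ l = 1" using zeta_pow_self[OF l_pos] by (simp add: \<xi>_def)
  have v\<xi>: "v \<xi> = \<xi> ^ a"
  proof -
    have "v \<xi> = \<xi> ^ b" using \<xi> by (intro vroot) (metis mult.commute power_mult power_one)
    then show ?thesis using b(2) zeta_power_eq_iff[OF l_pos] by (simp add: \<xi>_def)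
  qed
  have vN: "v \<eta> = \<eta>" if \<eta>: "\<eta> ^ N = 1" for \<eta>
  proof -
    obtain j where j: "\<eta> = zeta N ^ j" using root_unity_is_zeta_power[OF N \<eta>] by metis
    have "\<eta> ^ b = zeta N ^ (j * b)" by (simp add: j power_mult)
    also have "\<dots> = zeta N ^ (j * 1)" unfolding zeta_power_eq_iff[OF N] using b(1) cong_scalar_left by blast
    finally have "\<eta> ^ b = \<eta>" by (simp add: j)
    then show ?thesis using vroot[of \<eta>] \<eta> by (simp add: power_mult)
  qed
  define x where "x = v \<circ> cnj \<circ> v \<circ> cnj"
  have x: "x \<in> Aut_Qbar" unfolding x_def by (intro aut_comp aut_cnj v)
  have x\<xi>: "x \<xi> = \<xi> ^ (a ^ 2)"
  proof -
    have "v (cnj \<xi>) = cnj (v \<xi>)"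
      by (rule aut_commute_root_of_unity[OF v(1) aut_cnj l_pos \<xi>])
    then have "x \<xi> = v (v \<xi>)" by (simp add: x_def)
    also have "\<dots> = \<xi> ^ (a ^ 2)" using v\<xi> aut_power[OF v(1) roots_of_unity_algebraic[OF \<xi> l_pos]]
      by (simp add: power_mult[symmetric] power2_eq_square)
    finally show ?thesis .
  qed
  have xz: "x z = z" if z: "z ^ N \<in> \<rat>" for z
  proof -
    have az: "algebraic z" using z N rat_imp_algebraic algebraic_of_power by blast
    \<comment> \<open>Complex conjugation inverts \<open>\<eta>\<close> and \<open>\<mu>\<close>, so
      \<open>\<mu>\<close> cancels in \<open>cnj (v (cnj z))\<close>, and the outer \<open>v\<close>
      cancels the remaining inverse of \<open>\<eta>\<close>.\<close>
    obtain \<eta> where \<eta>: "\<eta> ^ N = 1" "v z = \<eta> * z" by (rule aut_radical_ratio[OF v(1) N z])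
    obtain \<mu> where \<mu>: "\<mu> ^ N = 1" "cnj z = \<mu> * z" by (rule aut_radical_ratio[OF aut_cnj N z])
    have alg: "algebraic \<eta>" "algebraic \<mu>" 
      using roots_of_unity_algebraic N \<eta>(1) \<mu>(1) by blast+
    have nz: "\<eta> \<noteq> 0" "\<mu> \<noteq> 0" using \<eta>(1) \<mu>(1) N by (auto simp: power_0_left)
    have "v (cnj z) = \<mu> * (\<eta> * z)" using \<mu>(2) aut_mult[OF v(1) alg(2) az] vN[OF \<mu>(1)] \<eta>(2) by simp
    then have "cnj (v (cnj z)) = inverse \<mu> * (inverse \<eta> * (\<mu> * z))"
      using cnj_root_of_unity[OF \<mu>(1) N] cnj_root_of_unity[OF \<eta>(1) N] \<mu>(2) by simp
    also have "\<dots> = inverse \<eta> * z" using nz by simp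
    finally have "x z = v (inverse \<eta> * z)" by (simp add: x_def)
    also have "\<dots> = inverse \<eta> * (\<eta> * z)"
      using aut_mult[OF v(1) algebraic_inverse[OF alg(1)] az] aut_inverse[OF v(1) alg(1)] vN[OF \<eta>(1)] \<eta>(2) by simp
    finally show ?thesis using nz by simp
  qed
  define y where "y = x ^^ fact f"
  have "y \<in> Aut_Qbar" unfolding y_def by (rule aut_funpow[OF x])
  moreover have "y w = w" if "w \<in> F" for w
    unfolding y_def using orbit[OF that] by (intro funpow_fact_fixes x F that) auto
  moreover have "y z = z" if "z ^ N \<in> \<rat>" for z
    unfolding y_def using xz[OF that] by (rule funpow_fixes)
  moreover have "(x ^^ k) \<xi> = \<xi> ^ ((a ^ 2) ^ k)" for k
  proof (induction k)
    case (Suc k)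
    then show ?case using x\<xi> aut_power[OF x roots_of_unity_algebraic[OF \<xi> l_pos]]
      by (simp add: power_mult[symmetric] mult.commute)
  qed simp
  then have "y (zeta l) = zeta l ^ (a ^ (2 * fact f))"
    unfolding y_def \<xi>_def by (simp add: power_mult)
  ultimately show ?thesis using that by metis
qed

text \<open>\<open>H\<close> consists of the maps \<open>y d \<circ> (U ^^ b)\<close>: the image of
  \<open>zeta l\<close> determines the power residue \<open>d\<close>, and then the image of
  \<theta> determines \<open>b < l\<close>. By \<open>power_residues_card\<close> there are at least
  \<open>(l - 1) / (2 * fact f)\<close> residues.\<close>

theorem many_conjugates:
  obtains H where "H \<subseteq> Aut_Qbar" "finite H"
    "\<And>h x. h \<in> H \<Longrightarrow> x \<in> F \<Longrightarrow> h x = x" "\<And>h z. h \<in> H \<Longrightarrow> z ^ N \<in> \<rat> \<Longrightarrow> h z = z"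
    "inj_on (\<lambda>h. (h (zeta l), h \<theta>)) H" "l * (l - 1) \<le> card H * (2 * fact f)"
proof -
  obtain U \<kappa> where U: "U \<in> Aut_Qbar" "\<And>x. x \<in> F \<Longrightarrow> U x = x" "\<And>z. z ^ N \<in> \<rat> \<Longrightarrow> U z = z"
    "U (zeta l) = zeta l" and \<kappa>: "\<kappa> ^ l = 1" "\<kappa> \<noteq> 1" "U \<theta> = \<kappa> * \<theta>" "U \<kappa> = \<kappa>"
    by (rule radical_translation) blast
  define D where "D = (\<lambda>a. a ^ (2 * fact f) mod l) ` {1..<l}"
  have "\<exists>y. y \<in> Aut_Qbar \<and> (\<forall>x\<in>F. y x = x) \<and> (\<forall>z. z ^ N \<in> \<rat> \<longrightarrow> y z = z) \<and> y (zeta l) = zeta l ^ d"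
    if d: "d \<in> D" for d
  proof -
    obtain a where a: "a \<in> {1..<l}" "d = a ^ (2 * fact f) mod l" using d unfolding D_def by blast
    have "coprime a l" using a(1) l(1)
      by (metis atLeastLessThan_iff coprime_commute nat_dvd_not_less not_less_eq_eq prime_imp_coprime One_nat_def le_simps(3))
    then obtain y where "y \<in> Aut_Qbar" "\<And>x. x \<in> F \<Longrightarrow> y x = x" "\<And>z. z ^ N \<in> \<rat> \<Longrightarrow> y z = z"
      "y (zeta l) = zeta l ^ (a ^ (2 * fact f))" by (rule cyclotomic_translation) blast
    moreover have "zeta l ^ (a ^ (2 * fact f)) = zeta l ^ d"
      unfolding zeta_power_eq_iff[OF l_pos] by (simp add: a(2) cong_def)
    ultimately show ?thesis by metis
  qed
  then obtain y where y: "\<And>d. d \<in> D \<Longrightarrow> y d \<in> Aut_Qbar" "\<And>d x. d \<in> D \<Longrightarrow> x \<in> F \<Longrightarrow> y d x = x"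
    "\<And>d z. d \<in> D \<Longrightarrow> z ^ N \<in> \<rat> \<Longrightarrow> y d z = z" "\<And>d. d \<in> D \<Longrightarrow> y d (zeta l) = zeta l ^ d"
    by metis
  define h where "h = (\<lambda>(d, b). y d \<circ> (U ^^ b))"
  define P where "P = (\<lambda>h. (h (zeta l), h \<theta>) :: complex \<times> complex)"
  have alg: "algebraic \<theta>" using \<theta>(3) l_pos rat_imp_algebraic algebraic_of_power by blast
  have alg\<kappa>: "algebraic \<kappa>" using roots_of_unity_algebraic[OF \<kappa>(1) l_pos] .
  have Ub: "(U ^^ b) \<theta> = \<kappa> ^ b * \<theta>" for b using funpow_scale[OF U(1) alg \<kappa>(3) alg\<kappa> \<kappa>(4)] .
  have \<theta>0: "\<theta> \<noteq> 0" using \<theta>(2) by auto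
  have inj: "inj_on (P \<circ> h) (D \<times> {..<l})"
  proof (rule inj_onI, clarify)
    fix d b d' b' assume d: "d \<in> D" "d' \<in> D" and b: "b < l" "b' < l"
      and "(P \<circ> h) (d, b) = (P \<circ> h) (d', b')"
    then have eq: "zeta l ^ d = zeta l ^ d'" "y d (\<kappa> ^ b * \<theta>) = y d' (\<kappa> ^ b' * \<theta>)"
      by (simp_all add: P_def h_def Ub y(4) funpow_fixes[of U, OF U(4)])
    have "d < l" "d' < l" using d l_pos by (auto simp: D_def)
    then have dd: "d = d'" using eq(1) unfolding zeta_power_eq_iff[OF l_pos] by (simp add: cong_less_modulus_unique_nat)
    have "\<kappa> ^ b * \<theta> = \<kappa> ^ b' * \<theta>"
      using eq(2) aut_eq_iff[OF y(1)[OF d(1)]] alg alg\<kappa> unfolding dd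
      by (simp add: algebraic_mult algebraic_power)
    then have k: "\<kappa> ^ b = \<kappa> ^ b'" using \<theta>0 by simp
    obtain j where j: "\<kappa> = zeta l ^ j" using root_unity_is_zeta_power[OF l_pos \<kappa>(1)] by metis
    have "\<not> l dvd j"
    proof
      assume "l dvd j"
      then have "zeta l ^ j = zeta l ^ 0" unfolding zeta_power_eq_iff[OF l_pos] by (simp add: cong_0_iff)
      then show False using j \<kappa>(2) by simp
    qed
    then have "coprime j l" using l(1) by (metis coprime_commute prime_imp_coprime)
    moreover have "[j * b = j * b'] (mod l)"
      using k unfolding j by (simp add: power_mult[symmetric] zeta_power_eq_iff[OF l_pos])
    ultimately have "[b = b'] (mod l)" by (simp add: cong_mult_lcancel_nat)
    then show "d = d' \<and> b = b'" using dd b by (simp add: cong_less_modulus_unique_nat)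
  qed
  define H where "H = h ` (D \<times> {..<l})"
  have "card H = card D * l"
    unfolding H_def using inj by (subst card_image) (auto simp: inj_on_imageI2 card_cartesian_product)
  moreover have "l * (l - 1) \<le> l * (card D * (2 * fact f))"
    unfolding D_def by (intro mult_le_mono2 power_residues_card[OF l(1)]) simp
  ultimately have "l * (l - 1) \<le> card H * (2 * fact f)" by (simp add: mult_ac)
  moreover have "inj_on (\<lambda>h. (h (zeta l), h \<theta>)) H"
    unfolding H_def P_def[symmetric] by (rule inj_on_imageI[OF inj])
  moreover have "H \<subseteq> Aut_Qbar"
  proof
    fix k assume "k \<in> H"
    then obtain d b where "d \<in> D" "k = y d \<circ> (U ^^ b)" unfolding H_def h_def by auto
    then show "k \<in> Aut_Qbar" using aut_comp[OF y(1) aut_funpow[OF U(1)]] by blast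
  qed
  moreover have "finite H" by (simp add: H_def D_def)
  moreover have "k x = x" if k: "k \<in> H" and x: "x \<in> F" for k x
  proof -
    have "(U ^^ b) x = x" for b using U(2)[OF x] by (rule funpow_fixes)
    then show ?thesis using k y(2)[OF _ x] unfolding H_def h_def by auto
  qed
  moreover have "k z = z" if k: "k \<in> H" and z: "z ^ N \<in> \<rat>" for k z
  proof -
    have "(U ^^ b) z = z" for b using U(3)[OF z] by (rule funpow_fixes)
    then show ?thesis using k y(3)[OF _ z] unfolding H_def h_def by auto
  qed
  ultimately show ?thesis by (intro that[of H])
qed

end

section \<open>Densities along the tower\<close>

lemma root_set_radical:
  assumes "V \<subseteq> \<rat>" "z \<in> root_set V q" "q dvd N" shows "z ^ N \<in> \<rat>"
proof -
  obtain m where "N = q * m" using assms(3) by (elim dvdE)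
  then show ?thesis using assms(1,2) by (auto simp: root_set_def power_mult)
qed

text \<open>Since \<open>l ^ k > k\<close>, some power of \<open>l\<close> fails to divide
  \<open>k\<close>, so the least one exists. Its exponent is not 0, because 1 divides
  \<open>k\<close>.\<close>

lemma q_power_prime_power:
  assumes "Factorial_Ring.prime l" "k > 0"
  obtains e where "q_power k l = l ^ e" "e > 0"
proof -
  have l1: "l > 1" using assms(1) prime_gt_1_nat by blast
  have "k < 2 ^ k" by (rule less_exp)
  also have "2 ^ k \<le> l ^ k" using l1 by (intro power_mono) auto
  finally have "k < l ^ k" .
  then have "\<not> l ^ k dvd k" using assms(2) by (meson dvd_imp_le not_less)
  then have ex: "\<exists>m. (\<exists>e. m = l ^ e) \<and> \<not> m dvd k" by blast
  have "(\<exists>e. q_power k l = l ^ e) \<and> \<not> q_power k l dvd k"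
    unfolding q_power_def by (rule LeastI_ex[OF ex])
  then obtain e where e: "q_power k l = l ^ e" "\<not> l ^ e dvd k" by auto
  then have "e > 0" by (cases e) auto
  then show ?thesis using e that by blast
qed

lemma q_power_pos: "Factorial_Ring.prime l \<Longrightarrow> k > 0 \<Longrightarrow> q_power k l > 0"
  by (rule q_power_prime_power[of l k]) (auto simp: prime_gt_0_nat)

text \<open>At large primes all the exponents are thus \<open>l\<close> itself, so
  \<open>K_field W k i l\<close> is generated by \<open>zeta l\<close> and \<open>l\<close>-th
  roots.\<close>

lemma q_power_not_dvd:
  assumes "Factorial_Ring.prime l" "\<not> l dvd k"
  shows "q_power k l = l"
  unfolding q_power_def
proof (rule Least_equality)
  show "(\<exists>e. l = l ^ e) \<and> \<not> l dvd k" using assms(2) by (auto intro: exI[of _ 1])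
  fix m assume "(\<exists>e. m = l ^ e) \<and> \<not> m dvd k"
  then obtain e where e: "m = l ^ e" "\<not> m dvd k" by blast
  then have "e > 0" by (cases e) auto
  then show "l \<le> m" using e prime_gt_0_nat[OF assms(1)] self_le_power[of l e] by simp
qed

lemma zeta_dvd: 
  assumes "a dvd b" "b > 0" shows "zeta a = zeta b ^ (b div a)"
proof -
  obtain m where m: "b = a * m" using assms(1) by (elim dvdE)
  then have "a > 0" "m > 0" using assms(2) by auto
  have "zeta (a * m) ^ m = cis (2 * pi * real m / real (a * m))" by (rule zeta_power)
  also have "\<dots> = zeta a" using \<open>m > 0\<close> by (simp add: zeta_def)
  finally show ?thesis using \<open>a > 0\<close> m by simp
qed

section \<open>Fibres of the restriction map between Galois groups\<close>

lemma stable_algebraic: "stable M \<Longrightarrow> x \<in> M \<Longrightarrow> algebraic x"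
  and stable_image: "stable M \<Longrightarrow> g \<in> Aut_Qbar \<Longrightarrow> x \<in> M \<Longrightarrow> g x \<in> M"
  by (auto simp: stable_def)

text \<open>Composition with an automorphism that carries \<open>\<sigma>\<close> to
  \<open>\<sigma>'\<close> on \<open>M\<close> embeds one fibre into the other.\<close>

lemma galois_fiber_card_le:
  assumes M: "stable M" and M': "stable M'" "M \<subseteq> M'" and fin: "finite (carrier (galois_group M' \<rat>))"
    and \<sigma>: "\<sigma> \<in> carrier (galois_group M \<rat>)" and \<sigma>': "\<sigma>' \<in> carrier (galois_group M \<rat>)"
  shows "card {\<tau> \<in> carrier (galois_group M' \<rat>). restrict \<tau> M = \<sigma>}
    \<le> card {\<tau> \<in> carrier (galois_group M' \<rat>). restrict \<tau> M = \<sigma>'}"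
proof -
  note G = carrier_galois_group_stable[OF M] and G' = carrier_galois_group_stable[OF M'(1)]
  obtain g where g: "g \<in> Aut_Qbar" "\<sigma> = restrict g M" using \<sigma> G by auto
  obtain g' where g': "g' \<in> Aut_Qbar" "\<sigma>' = restrict g' M" using \<sigma>' G by auto
  obtain h where h: "h \<in> Aut_Qbar" "\<And>x. algebraic x \<Longrightarrow> h (g x) = x" by (rule aut_inv[OF g(1)]) blast
  define k where "k = g' \<circ> h"
  have k: "k \<in> Aut_Qbar" unfolding k_def by (intro aut_comp g' h)
  have kg: "k (g x) = g' x" if "x \<in> M" for x
    using h(2)[OF stable_algebraic[OF M that]] by (simp add: k_def)
  show ?thesis
  proof (rule card_inj_on_le[of "\<lambda>\<tau>. restrict (k \<circ> \<tau>) M'"])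
    show "inj_on (\<lambda>\<tau>. restrict (k \<circ> \<tau>) M') {\<tau> \<in> carrier (galois_group M' \<rat>). restrict \<tau> M = \<sigma>}"
    proof (rule inj_onI, clarify)
      fix \<tau> \<rho> assume "\<tau> \<in> carrier (galois_group M' \<rat>)" "\<rho> \<in> carrier (galois_group M' \<rat>)"
        and eq: "restrict (k \<circ> \<tau>) M' = restrict (k \<circ> \<rho>) M'"
      then obtain t r where t: "t \<in> Aut_Qbar" "\<tau> = restrict t M'" and r: "r \<in> Aut_Qbar" "\<rho> = restrict r M'"
        using G' by auto
      show "\<tau> = \<rho>"
      proof
        fix x
        show "\<tau> x = \<rho> x"
        proof (cases "x \<in> M'")
          case True
          then have "k (t x) = k (r x)" using fun_cong[OF eq, of x] t r by simp
          then show ?thesis using True t r aut_eq_iff[OF k]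
            by (simp add: aut_algebraic stable_algebraic[OF M'(1)])
        qed (simp add: t r)
      qed
    qed
    show "(\<lambda>\<tau>. restrict (k \<circ> \<tau>) M') ` {\<tau> \<in> carrier (galois_group M' \<rat>). restrict \<tau> M = \<sigma>}
      \<subseteq> {\<tau> \<in> carrier (galois_group M' \<rat>). restrict \<tau> M = \<sigma>'}"
    proof clarify
      fix \<tau> assume "\<tau> \<in> carrier (galois_group M' \<rat>)" and \<tau>: "\<sigma> = restrict \<tau> M"
      then obtain t where t: "t \<in> Aut_Qbar" "\<tau> = restrict t M'" using G' by auto
      have "restrict (k \<circ> \<tau>) M' = restrict (k \<circ> t) M'" by (auto simp: t)
      then have "restrict (k \<circ> \<tau>) M' \<in> carrier (galois_group M' \<rat>)"
        unfolding G' using aut_comp[OF k t(1)] by blast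
      moreover have "restrict (restrict (k \<circ> \<tau>) M') M = \<sigma>'"
      proof
        fix x
        show "restrict (restrict (k \<circ> \<tau>) M') M x = \<sigma>' x"
        proof (cases "x \<in> M")
          case True
          then have "\<tau> x = g x" using fun_cong[OF \<tau>, of x] g by simp
          then show ?thesis using True M'(2) kg by (auto simp: g')
        qed (simp add: g')
      qed
      ultimately show "restrict (k \<circ> \<tau>) M' \<in> carrier (galois_group M' \<rat>) \<and>
        restrict (restrict (k \<circ> \<tau>) M') M = \<sigma>'" by blast
    qed
    show "finite {\<tau> \<in> carrier (galois_group M' \<rat>). restrict \<tau> M = \<sigma>'}" using fin by simp
  qed
qed

lemma restrict_galois_group:
  assumes M: "stable M" and M': "stable M'" "M \<subseteq> M'" and "\<tau> \<in> carrier (galois_group M' \<rat>)"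
  shows "restrict \<tau> M \<in> carrier (galois_group M \<rat>)"
proof -
  obtain t where t: "t \<in> Aut_Qbar" "\<tau> = restrict t M'"
    using assms(4) carrier_galois_group_stable[OF M'(1)] by auto
  have "restrict \<tau> M = restrict t M" using M'(2) by (auto simp: t fun_eq_iff)
  then show ?thesis using t carrier_galois_group_stable[OF M] by auto
qed

text \<open>By the inequality in both directions, all fibres are as large as the one over the
  identity, so \<open>c\<close> plays the role of the degree of \<open>M'\<close> over
  \<open>M\<close>. Surjectivity of restriction makes \<open>c\<close> positive and the lower group
  finite.\<close>

lemma galois_fiber_card:
  assumes M: "stable M" and M': "stable M'" "M \<subseteq> M'" and fin: "finite (carrier (galois_group M' \<rat>))"
  obtains c where "c > 0" "\<And>S. S \<subseteq> carrier (galois_group M \<rat>) \<Longrightarrow>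
     card {\<tau> \<in> carrier (galois_group M' \<rat>). restrict \<tau> M \<in> S} = c * card S"
    "finite (carrier (galois_group M \<rat>))"
proof -
  let ?G = "carrier (galois_group M \<rat>)" and ?G' = "carrier (galois_group M' \<rat>)"
  note G = carrier_galois_group_stable[OF M] and G' = carrier_galois_group_stable[OF M'(1)]
  define fib where "fib \<sigma> = {\<tau> \<in> ?G'. restrict \<tau> M = \<sigma>}" for \<sigma>
  define e where "e = restrict (\<lambda>x. x) M"
  have e: "e \<in> ?G" unfolding G e_def using aut_id by blast
  have G_im: "?G = (\<lambda>\<tau>. restrict \<tau> M) ` ?G'"
  proof (intro equalityI subsetI)
    fix \<sigma> assume "\<sigma> \<in> ?G"
    then obtain g where g: "g \<in> Aut_Qbar" "\<sigma> = restrict g M" using G by auto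
    then have "\<sigma> = restrict (restrict g M') M" using M'(2) by (auto simp: fun_eq_iff)
    then show "\<sigma> \<in> (\<lambda>\<tau>. restrict \<tau> M) ` ?G'" using g(1) G' by blast
  qed (auto intro: restrict_galois_group[OF M M'])
  have finG: "finite ?G" unfolding G_im using fin by simp
  have fib: "card (fib \<sigma>) = card (fib e)" if "\<sigma> \<in> ?G" for \<sigma>
    unfolding fib_def using galois_fiber_card_le[OF M M' fin] that e by (intro antisym) blast+
  have finfib: "finite (fib \<sigma>)" for \<sigma> using fin by (simp add: fib_def)
  have "fib e \<noteq> {}" using e unfolding G_im fib_def by auto
  then have "card (fib e) > 0" using finfib by (simp add: card_gt_0_iff)
  moreover have "card {\<tau> \<in> ?G'. restrict \<tau> M \<in> S} = card (fib e) * card S" if S: "S \<subseteq> ?G" for S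
  proof -
    have "{\<tau> \<in> ?G'. restrict \<tau> M \<in> S} = (\<Union>\<sigma>\<in>S. fib \<sigma>)" by (auto simp: fib_def)
    then have "card {\<tau> \<in> ?G'. restrict \<tau> M \<in> S} = card (\<Union>\<sigma>\<in>S. fib \<sigma>)" by simp
    also have "\<dots> = (\<Sum>\<sigma>\<in>S. card (fib \<sigma>))"
      using finite_subset[OF S finG] finfib by (intro card_UN_disjoint) (auto simp: fib_def)
    also have "\<dots> = (\<Sum>\<sigma>\<in>S. card (fib e))" using S fib by (intro sum.cong) auto
    finally show ?thesis by simp
  qed
  ultimately show ?thesis using that finG by blast
qed

text \<open>A maximum over a nonempty range is attained, so the first generator is some
  \<open>zeta (q_power (k i) l)\<close>. For \<open>t = 0\<close> the maximum is unspecified and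
  gets its own case.\<close>

lemma L_prime_cases:
  fixes t :: nat
  assumes "t = 0 \<Longrightarrow> P (zeta (MAX i\<in>{1..t}. q_power (k i) l))"
    "\<And>i. i \<in> {1..t} \<Longrightarrow> P (zeta (q_power (k i) l))"
    "\<And>i x. i \<in> {1..t} \<Longrightarrow> x \<in> root_set (W i) (q_power (k i) l) \<Longrightarrow> P x"
    "x \<in> {zeta (MAX i\<in>{1..t}. q_power (k i) l)} \<union> (\<Union>i\<in>{1..t}. root_set (W i) (q_power (k i) l))"
  shows "P x"
proof (cases "x = zeta (MAX i\<in>{1..t}. q_power (k i) l)")
  case True
  show ?thesis
  proof (cases "t = 0")
    case False
    then have "(MAX i\<in>{1..t}. q_power (k i) l) \<in> (\<lambda>i. q_power (k i) l) ` {1..t}" by (intro Max_in) auto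
    then obtain i where "i \<in> {1..t}" "(MAX i\<in>{1..t}. q_power (k i) l) = q_power (k i) l" by auto
    then show ?thesis using True assms(2) by metis
  qed (use True assms(1) in simp)
qed (use assms(3,4) in auto)

text \<open>Finiteness of the Galois groups enters as an assumption; the main theorem reads it off
  from the nonvanishing of the densities.\<close>

locale tower =
  fixes t :: nat and W :: "nat \<Rightarrow> complex set" and k :: "nat \<Rightarrow> nat" and F :: "complex set"
    and C :: "(complex \<Rightarrow> complex) set"
  assumes W_rat: "\<And>i. i \<in> {1..t} \<Longrightarrow> W i \<subseteq> \<rat>"
    and k_pos: "\<And>i. i \<in> {1..t} \<Longrightarrow> k i > 0"
    and stable_F: "stable F"
    and fin: "\<And>n. squarefree n \<Longrightarrow> finite (carrier (galois_group (FL_field t W k F n) \<rat>))"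
begin

abbreviation FL where "FL n \<equiv> FL_field t W k F n"
abbreviation G where "G n \<equiv> carrier (galois_group (FL n) \<rat>)"
abbreviation CS where "CS n \<equiv> C_set t W k F C n"

lemma aut_zeta: "g \<in> Aut_Qbar \<Longrightarrow> zeta m \<in> S \<Longrightarrow> g (zeta m) \<in> QQ_adjoin S"
proof -
  assume g: "g \<in> Aut_Qbar" and S: "zeta m \<in> S"
  show ?thesis
  proof (cases "m = 0")
    \<comment> \<open>\<open>zeta 0\<close> is 1, because division by 0 gives 0; the unspecified
      maximum for \<open>t = 0\<close> may lead here.\<close>
    case True
    then show ?thesis using aut_1[OF g] by (simp add: zeta_def QQ_adjoin_rat)
  next
    case False
    then obtain j where j: "g (zeta m) = zeta m ^ j"
      using root_unity_is_zeta_power[OF _ aut_root_of_unity[OF g zeta_pow_self]] by (metis neq0_conv)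
    have "zeta m ^ j \<in> QQ_adjoin S"
      by (induction j) (auto intro: QQ_adjoin_rat QQ_adjoin_closed QQ_adjoin_incl S)
    then show ?thesis using j by simp
  qed
qed

lemma root_set_stable:
  assumes "i \<in> {1..t}" "q > 0" "x \<in> root_set (W i) q"
  shows "algebraic x" "g \<in> Aut_Qbar \<Longrightarrow> g x \<in> root_set (W i) q"
proof -
  have xq: "x ^ q \<in> W i" using assms(3) by (simp add: root_set_def)
  then show alg: "algebraic x"
    using W_rat[OF assms(1)] assms(2) rat_imp_algebraic algebraic_of_power by blast
  assume g: "g \<in> Aut_Qbar"
  have "g x ^ q = x ^ q" using aut_power[OF g alg, of q] aut_rat[OF g, of "x ^ q"] W_rat[OF assms(1)] xq by auto
  then show "g x \<in> root_set (W i) q" using xq by (simp add: root_set_def)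
qed

lemma stable_L_prime:
  assumes l: "Factorial_Ring.prime l" shows "stable (L_prime t W k l)"
  unfolding L_prime_def
proof (rule stable_QQ_adjoin)
  let ?S = "{zeta (MAX i\<in>{1..t}. q_power (k i) l)} \<union> (\<Union>i\<in>{1..t}. root_set (W i) (q_power (k i) l))"
  note root = root_set_stable[OF _ q_power_pos[OF l k_pos]]
  show "algebraic x" if "x \<in> ?S" for x
    using that root(1) algebraic_zeta by auto
  show "g x \<in> QQ_adjoin ?S" if g: "g \<in> Aut_Qbar" and x: "x \<in> ?S" for g x
  proof (cases "x = zeta (MAX i\<in>{1..t}. q_power (k i) l)")
    case True
    then show ?thesis using aut_zeta[OF g] by simp
  next
    case False
    then obtain i where "i \<in> {1..t}" "x \<in> root_set (W i) (q_power (k i) l)" using x by auto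
    then have "g x \<in> ?S" using root(2)[OF _ _ _ g] by blast
    then show ?thesis by (rule QQ_adjoin_incl)
  qed
qed

lemma stable_L_field: "stable (L_field t W k n)"
  unfolding L_field_def
proof (rule stable_QQ_adjoin)
  let ?S = "\<Union>l\<in>{l. Factorial_Ring.prime l \<and> l dvd n}. L_prime t W k l"
  show "algebraic x" if "x \<in> ?S" for x using that stable_L_prime stable_algebraic by blast
  show "g x \<in> QQ_adjoin ?S" if "g \<in> Aut_Qbar" "x \<in> ?S" for g x
  proof (rule QQ_adjoin_incl)
    show "g x \<in> ?S" using that stable_L_prime stable_image by blast
  qed
qed

lemma stable_FL: "stable (FL n)"
  unfolding FL_field_def
proof (rule stable_QQ_adjoin)
  show "algebraic x" if "x \<in> F \<union> L_field t W k n" for x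
    using that stable_L_field stable_F stable_algebraic by blast
  show "g x \<in> QQ_adjoin (F \<union> L_field t W k n)" if "g \<in> Aut_Qbar" "x \<in> F \<union> L_field t W k n" for g x
  proof (rule QQ_adjoin_incl)
    show "g x \<in> F \<union> L_field t W k n"
      using that stable_L_field stable_F stable_image by blast
  qed
qed

lemma F_subset_FL: "F \<subseteq> FL n"
  by (auto simp: FL_field_def intro: QQ_adjoin_incl)

lemma L_prime_subset_FL:
  assumes "Factorial_Ring.prime l" "l dvd n" shows "L_prime t W k l \<subseteq> FL n"
proof -
  have "L_prime t W k l \<subseteq> L_field t W k n"
    unfolding L_field_def using assms by (blast intro: QQ_adjoin_incl)
  also have "\<dots> \<subseteq> FL n" unfolding FL_field_def by (blast intro: QQ_adjoin_incl)
  finally show ?thesis .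
qed

lemma FL_mono:
  assumes "n dvd m" shows "FL n \<subseteq> FL m"
proof -
  have "L_field t W k n \<subseteq> L_field t W k m"
    unfolding L_field_def using assms by (intro QQ_adjoin_mono subsetI QQ_adjoin_incl) (blast intro: dvd_trans)
  then show ?thesis unfolding FL_field_def 
    by (intro QQ_adjoin_mono subsetI QQ_adjoin_incl) blast
qed

text \<open>The \<open>q_power (k j) l\<close> are powers of one prime, so each divides their
  maximum, and \<open>zeta\<close> of the maximum generates the other roots of unity.\<close>

lemma K_field_subset_FL:
  assumes i: "i \<in> {1..t}" and l: "Factorial_Ring.prime l" "l dvd n"
  shows "K_field W k i l \<subseteq> FL n"
proof -
  have "K_field W k i l \<subseteq> L_prime t W k l"
    unfolding K_field_def L_prime_def
  proof (rule QQ_adjoin_mono, rule subsetI)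
    let ?M = "MAX i\<in>{1..t}. q_power (k i) l"
    let ?S = "{zeta ?M} \<union> (\<Union>i\<in>{1..t}. root_set (W i) (q_power (k i) l))"
    fix x assume x: "x \<in> {zeta (q_power (k i) l)} \<union> root_set (W i) (q_power (k i) l)"
    show "x \<in> QQ_adjoin ?S"
    proof (cases "x = zeta (q_power (k i) l)")
      case True
      obtain e where e: "q_power (k i) l = l ^ e" using q_power_prime_power[OF l(1) k_pos[OF i]] by metis
      have "?M \<in> (\<lambda>i. q_power (k i) l) ` {1..t}" using i by (intro Max_in) auto
      then obtain j where j: "j \<in> {1..t}" "?M = q_power (k j) l" by auto
      obtain e' where e': "?M = l ^ e'" using q_power_prime_power[OF l(1) k_pos[OF j(1)]] j(2) by metis
      have "q_power (k i) l \<le> ?M" using i by (intro Max_ge) auto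
      then have "e \<le> e'" using e e' prime_gt_1_nat[OF l(1)] by simp
      then have "q_power (k i) l dvd ?M" unfolding e e' by (rule le_imp_power_dvd)
      moreover have "?M > 0" using e' prime_gt_0_nat[OF l(1)] by simp
      ultimately have "x = zeta ?M ^ (?M div q_power (k i) l)" using zeta_dvd True by blast
      moreover have "zeta ?M ^ j \<in> QQ_adjoin ?S" for j
        by (induction j) (auto intro: QQ_adjoin_rat QQ_adjoin_closed QQ_adjoin_incl)
      ultimately show ?thesis by simp
    next
      case False
      then have "x \<in> ?S" using x i by auto
      then show ?thesis by (rule QQ_adjoin_incl)
    qed
  qed
  then show ?thesis using L_prime_subset_FL[OF l] by blast
qed

lemma CS_subset: "CS n \<subseteq> G n"
  by (auto simp: C_set_def)

lemma CS_nontrivial: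
  assumes "\<tau> \<in> CS n" "i \<in> {1..t}" "Factorial_Ring.prime l" "l dvd n"
  obtains x where "x \<in> K_field W k i l" "\<tau> x \<noteq> x"
  using assms unfolding C_set_def by blast

lemma dens_altdef: "dens t W k F C n = real (card (CS n)) / real (card (G n))"
  by (simp add: dens_def Coset.order_def)

lemma restrict_CS:
  assumes "n dvd m" "\<tau> \<in> CS m" shows "restrict \<tau> (FL n) \<in> CS n"
  unfolding C_set_def
proof (intro CollectI conjI ballI allI impI)
  have \<tau>: "\<tau> \<in> G m" using assms(2) CS_subset by blast
  show "restrict \<tau> (FL n) \<in> G n"
    by (rule restrict_galois_group[OF stable_FL stable_FL FL_mono[OF assms(1)] \<tau>])
  have "restrict (restrict \<tau> (FL n)) F = restrict \<tau> F" using F_subset_FL by (auto simp: fun_eq_iff)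
  then show "restrict (restrict \<tau> (FL n)) F \<in> C" using assms(2) by (simp add: C_set_def)
  fix i l assume i: "i \<in> {1..t}" and l: "Factorial_Ring.prime l \<and> l dvd n"
  then obtain x where "x \<in> K_field W k i l" "\<tau> x \<noteq> x"
    using CS_nontrivial[OF assms(2) i] dvd_trans[OF _ assms(1)] by blast
  moreover have "x \<in> FL n" using K_field_subset_FL i l \<open>x \<in> K_field W k i l\<close> by blast
  ultimately show "\<not> (\<forall>x\<in>K_field W k i l. restrict \<tau> (FL n) x = x)" by auto
qed

lemma dens_nonneg: "dens t W k F C n \<ge> 0"
  by (simp add: dens_altdef)

text \<open>From level \<open>n\<close> to level \<open>m\<close> the group order grows by exactly
  the factor \<open>c\<close> and, by \<open>restrict_CS\<close>, the numerator by at most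
  \<open>c\<close>.\<close>

lemma dens_antimono:
  assumes "squarefree m" "n dvd m"
  shows "dens t W k F C m \<le> dens t W k F C n"
proof -
  obtain c where c: "c > 0" "\<And>S. S \<subseteq> G n \<Longrightarrow> card {\<tau> \<in> G m. restrict \<tau> (FL n) \<in> S} = c * card S"
    and "finite (G n)"
    by (rule galois_fiber_card[OF stable_FL stable_FL FL_mono[OF assms(2)] fin[OF assms(1)]]) blast
  have "{\<tau> \<in> G m. restrict \<tau> (FL n) \<in> G n} = G m"
    using restrict_galois_group[OF stable_FL stable_FL FL_mono[OF assms(2)]] by blast
  then have Gm: "card (G m) = c * card (G n)" using c(2)[of "G n"] by simp
  have "card (CS m) \<le> card {\<tau> \<in> G m. restrict \<tau> (FL n) \<in> CS n}"
    using fin[OF assms(1)] restrict_CS[OF assms(2)] CS_subset by (intro card_mono) auto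
  then have "card (CS m) \<le> c * card (CS n)" using c(2)[OF CS_subset] by simp
  then have "real (card (CS m)) \<le> real c * real (card (CS n))" by (metis of_nat_le_iff of_nat_mult)
  then have "real (card (CS m)) / (real c * real (card (G n))) \<le> real c * real (card (CS n)) / (real c * real (card (G n)))"
    by (rule divide_right_mono) simp
  then have "dens t W k F C m \<le> real c * real (card (CS n)) / (real c * real (card (G n)))"
    unfolding dens_altdef Gm of_nat_mult .
  also have "\<dots> = dens t W k F C n" unfolding dens_altdef using c(1) by simp
  finally show ?thesis .
qed

text \<open>\<open>FL n\<close> is generated by \<open>F\<close> and by \<open>N\<close>-th roots of
  rational numbers, as \<open>N\<close> is a multiple of every exponent. With \<open>t > 0\<close>
  this covers the root of unity of maximal order.\<close>

lemma fixed_FL: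
  assumes h: "h \<in> Aut_Qbar" and n: "n > 0" and t: "t > 0" and N: "N > 0"
    "\<And>i p. i \<in> {1..t} \<Longrightarrow> Factorial_Ring.prime p \<Longrightarrow> p dvd n \<Longrightarrow> q_power (k i) p dvd N"
    and F: "\<And>x. x \<in> F \<Longrightarrow> h x = x" and rad: "\<And>z. z ^ N \<in> \<rat> \<Longrightarrow> h z = z"
    and x: "x \<in> FL n"
  shows "h x = x"
proof -
  have L: "h x = x" if p: "Factorial_Ring.prime p" "p dvd n" and x: "x \<in> L_prime t W k p" for p x
    using x unfolding L_prime_def
  proof (rule QQ_adjoin_fixed[OF h, rotated])
    fix x assume x: "x \<in> {zeta (MAX i\<in>{1..t}. q_power (k i) p)} \<union> (\<Union>i\<in>{1..t}. root_set (W i) (q_power (k i) p))"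
    have "x ^ N \<in> \<rat>"
    proof (rule L_prime_cases[OF _ _ _ x])
      fix i assume i: "i \<in> {1..t}"
      obtain m where "N = q_power (k i) p * m" using N(2)[OF i p] by (elim dvdE)
      then show "zeta (q_power (k i) p) ^ N \<in> \<rat>"
        using zeta_pow_self[OF q_power_pos[OF p(1) k_pos[OF i]]] by (simp add: power_mult)
    next
      fix i x assume i: "i \<in> {1..t}" and "x \<in> root_set (W i) (q_power (k i) p)"
      then show "x ^ N \<in> \<rat>" using root_set_radical W_rat N(2)[OF i p] by blast
    qed (use t in simp)
    then show "algebraic x \<and> h x = x"
      using rad N(1) rat_imp_algebraic algebraic_of_power by blast
  qed
  have L': "h x = x" if x: "x \<in> L_field t W k n" for x
    using x unfolding L_field_def
    by (rule QQ_adjoin_fixed[OF h, rotated]) (use L stable_algebraic[OF stable_L_prime] in blast)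
  show ?thesis
    using x unfolding FL_field_def
    by (rule QQ_adjoin_fixed[OF h, rotated]) (use F L' stable_algebraic[OF stable_L_field] stable_algebraic[OF stable_F] in blast)
qed

text \<open>
  The automorphisms \<open>h\<close> from \<open>many_conjugates\<close> fix \<open>FL n\<close>, and \<open>h\<close> can be recovered from
  \<open>h \<circ> \<tau>\<close> if \<open>\<tau>\<close> is trivial on \<open>K_field W k i l\<close>, so that \<open>B \<times> H\<close> embeds into \<open>E\<close>.
\<close>

lemma trivial_extensions_card:
  fixes f :: nat
  assumes n: "n > 0" and l: "Factorial_Ring.prime l" "\<not> l dvd n" "l \<noteq> 2" "l > f" "\<not> l dvd k i"
    and fin': "finite (G (n * l))" and i: "i \<in> {1..t}"
    and orbit: "\<And>x. x \<in> F \<Longrightarrow> finite ((\<lambda>g. g x) ` Aut_Qbar) \<and> card ((\<lambda>g. g x) ` Aut_Qbar) \<le> f"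
    and \<theta>: "\<theta> \<in> \<real>" "\<theta> \<notin> \<rat>" "\<theta> ^ l \<in> W i"
  defines "E \<equiv> {\<tau> \<in> G (n * l). restrict \<tau> (FL n) \<in> CS n}"
  defines "B \<equiv> {\<tau> \<in> E. \<forall>x\<in>K_field W k i l. \<tau> x = x}"
  shows "card B * (l * (l - 1)) \<le> card E * (2 * fact f)"
proof -
  \<comment> \<open>A common multiple of all exponents at level \<open>n\<close>, prime to
    \<open>l\<close> because its prime factors divide \<open>n\<close>.\<close>
  define N where "N = (\<Prod>p\<in>prime_factors n. \<Prod>j\<in>{1..t}. q_power (k j) p)"
  have N: "N > 0" unfolding N_def
    by (intro prod_pos ballI q_power_pos k_pos) (auto simp: prime_factors_dvd)
  have dvdN: "q_power (k j) p dvd N" if "j \<in> {1..t}" "Factorial_Ring.prime p" "p dvd n" for j p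
  proof -
    have "p \<in> prime_factors n" using that n by (simp add: prime_factors_dvd)
    then show ?thesis unfolding N_def using that(1)
      by (meson dvd_prodI dvd_trans finite_atLeastAtMost finite_set_mset)
  qed
  have lN: "\<not> l dvd N"
  proof
    assume "l dvd N"
    then obtain p j where pj: "p \<in> prime_factors n" "j \<in> {1..t}" "l dvd q_power (k j) p"
      unfolding N_def using l(1) by (auto simp: prime_dvd_prod_iff)
    have p: "Factorial_Ring.prime p" "p dvd n" using pj(1) by auto
    obtain e where "q_power (k j) p = p ^ e" using q_power_prime_power[OF p(1) k_pos[OF pj(2)]] by metis
    then have "l = p" using pj(3) l(1) p(1) by (metis prime_dvd_power primes_dvd_imp_eq)
    then show False using p(2) l(2) by simp
  qed
  have \<theta>W: "\<theta> ^ l \<in> \<rat>" using \<theta>(3) W_rat[OF i] by blast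
  obtain H where H: "H \<subseteq> Aut_Qbar" "finite H"
    "\<And>h x. h \<in> H \<Longrightarrow> x \<in> F \<Longrightarrow> h x = x" "\<And>h z. h \<in> H \<Longrightarrow> z ^ N \<in> \<rat> \<Longrightarrow> h z = z"
    "inj_on (\<lambda>h. (h (zeta l), h \<theta>)) H" "l * (l - 1) \<le> card H * (2 * fact f)"
    by (rule many_conjugates[OF stable_algebraic[OF stable_F] orbit N l(1,3) lN l(4) \<theta>(1,2) \<theta>W]) blast+
  have q: "q_power (k i) l = l" by (rule q_power_not_dvd[OF l(1,5)])
  have \<xi>K: "zeta l \<in> K_field W k i l" and \<theta>K: "\<theta> \<in> K_field W k i l"
    unfolding K_field_def q using \<theta>(3) by (auto intro!: QQ_adjoin_incl simp: root_set_def)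
  have KFL: "K_field W k i l \<subseteq> FL (n * l)" by (rule K_field_subset_FL[OF i l(1)]) simp
  note G' = carrier_galois_group_stable[OF stable_FL[of "n * l"]]
  have FLsub: "FL n \<subseteq> FL (n * l)" by (rule FL_mono) simp
  have t: "t > 0" using i by simp
  have hfix: "h x = x" if h: "h \<in> H" and x: "x \<in> FL n" for h x
    by (rule fixed_FL[OF subsetD[OF H(1) h] n t N dvdN H(3)[OF h] H(4)[OF h] x])
  let ?m = "\<lambda>(\<tau>, h). restrict (h \<circ> \<tau>) (FL (n * l))"
  have "card (B \<times> H) \<le> card E"
  proof (rule card_inj_on_le[of ?m])
    show "finite E" using fin' by (simp add: E_def)
    show "?m ` (B \<times> H) \<subseteq> E"
    proof clarify
      fix \<tau> h assume \<tau>: "\<tau> \<in> B" and h: "h \<in> H"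
      have \<tau>E: "\<tau> \<in> G (n * l)" "restrict \<tau> (FL n) \<in> CS n" using \<tau> by (auto simp: B_def E_def)
      then obtain s where s: "s \<in> Aut_Qbar" "\<tau> = restrict s (FL (n * l))" using G' by auto
      have "restrict (h \<circ> \<tau>) (FL (n * l)) = restrict (h \<circ> s) (FL (n * l))" by (auto simp: s)
      then have "restrict (h \<circ> \<tau>) (FL (n * l)) \<in> G (n * l)"
        unfolding G' using aut_comp[of h s] H(1) h s(1) by blast
      moreover have "restrict (restrict (h \<circ> \<tau>) (FL (n * l))) (FL n) = restrict \<tau> (FL n)"
        using FLsub hfix[OF h stable_image[OF stable_FL s(1)]] by (auto simp: s fun_eq_iff)
      ultimately show "restrict (h \<circ> \<tau>) (FL (n * l)) \<in> E" using \<tau>E by (simp add: E_def)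
    qed
    show "inj_on ?m (B \<times> H)"
    proof (rule inj_onI, clarify)
      fix \<tau> h \<tau>' h' assume \<tau>: "\<tau> \<in> B" "\<tau>' \<in> B" and h: "h \<in> H" "h' \<in> H"
        and eq: "restrict (h \<circ> \<tau>) (FL (n * l)) = restrict (h' \<circ> \<tau>') (FL (n * l))"
      have ev: "h (\<tau> x) = h' (\<tau>' x)" if "x \<in> FL (n * l)" for x
        using fun_cong[OF eq, of x] that by simp
      have triv: "\<tau> x = x" "\<tau>' x = x" if "x \<in> K_field W k i l" for x using \<tau> that by (auto simp: B_def)
      have "h (zeta l) = h' (zeta l)" using ev[of "zeta l"] triv \<xi>K KFL by auto
      moreover have "h \<theta> = h' \<theta>" using ev[of \<theta>] triv \<theta>K KFL by auto
      ultimately have hh: "h = h'" using H(5) h by (auto simp: inj_on_def)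
      have "\<tau> \<in> G (n * l)" "\<tau>' \<in> G (n * l)" using \<tau> by (auto simp: B_def E_def)
      then obtain s s' where s: "s \<in> Aut_Qbar" "\<tau> = restrict s (FL (n * l))"
        and s': "s' \<in> Aut_Qbar" "\<tau>' = restrict s' (FL (n * l))" using G' by auto
      have "\<tau> x = \<tau>' x" for x
      proof (cases "x \<in> FL (n * l)")
        case True
        then have "algebraic (s x)" "algebraic (s' x)"
          using stable_algebraic[OF stable_FL] aut_algebraic s s' by blast+
        then show ?thesis using ev[OF True] True aut_eq_iff[of h "s x" "s' x"] H(1) h
          by (auto simp: s s' hh)
      qed (simp add: s s')
      then show "\<tau> = \<tau>' \<and> h = h'" using hh by auto
    qed
  qed
  then have "card B * card H \<le> card E" by (simp add: card_cartesian_product)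
  then have "card B * card H * (2 * fact f) \<le> card E * (2 * fact f)" by (rule mult_le_mono1)
  moreover have "card B * (l * (l - 1)) \<le> card B * (card H * (2 * fact f))"
    using H(6) by (rule mult_le_mono2)
  ultimately show ?thesis unfolding mult.assoc[of "card B" "card H"] by (rule order_trans[rotated])
qed

text \<open>\<open>E\<close> collects all extensions of members of \<open>CS n\<close>. Those
  outside \<open>CS (n * l)\<close> violate the condition at \<open>l\<close> for some
  \<open>i\<close>, so they lie in some \<open>B i\<close>; the bounds from
  \<open>trivial_extensions_card\<close> are summed over \<open>i\<close>.\<close>

lemma dens_step:
  fixes f :: nat
  assumes n: "squarefree (n * l)" and l: "Factorial_Ring.prime l" "\<not> l dvd n" "l \<noteq> 2" "l > f"
    and kl: "\<And>i. i \<in> {1..t} \<Longrightarrow> \<not> l dvd k i"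
    and orbit: "\<And>x. x \<in> F \<Longrightarrow> finite ((\<lambda>g. g x) ` Aut_Qbar) \<and> card ((\<lambda>g. g x) ` Aut_Qbar) \<le> f"
    and \<theta>: "\<And>i. i \<in> {1..t} \<Longrightarrow> \<exists>\<theta>. \<theta> \<in> \<real> \<and> \<theta> \<notin> \<rat> \<and> \<theta> ^ l \<in> W i"
  shows "dens t W k F C n * (1 - real (t * (2 * fact f)) / real (l * (l - 1))) \<le> dens t W k F C (n * l)"
proof -
  have n0: "n > 0" using n by (metis mult_0 neq0_conv not_squarefree_0)
  have l1: "l > 1" using l(1) prime_gt_1_nat by blast
  define E where "E = {\<tau> \<in> G (n * l). restrict \<tau> (FL n) \<in> CS n}"
  define B where "B i = {\<tau> \<in> E. \<forall>x\<in>K_field W k i l. \<tau> x = x}" for i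
  note fin' = fin[OF n]
  obtain c where c: "c > 0" "\<And>S. S \<subseteq> G n \<Longrightarrow> card {\<tau> \<in> G (n * l). restrict \<tau> (FL n) \<in> S} = c * card S"
    by (rule galois_fiber_card[OF stable_FL stable_FL FL_mono[OF dvd_triv_left] fin']) blast
  have "{\<tau> \<in> G (n * l). restrict \<tau> (FL n) \<in> G n} = G (n * l)"
    using restrict_galois_group[OF stable_FL stable_FL FL_mono[of n "n * l"]] by auto
  then have Gm: "card (G (n * l)) = c * card (G n)" using c(2)[of "G n"] by simp
  have E: "card E = c * card (CS n)" unfolding E_def by (rule c(2)[OF CS_subset])
  have finE: "finite E" using fin' by (simp add: E_def)
  have sub: "E \<subseteq> CS (n * l) \<union> (\<Union>i\<in>{1..t}. B i)"
  proof
    fix \<tau> assume \<tau>: "\<tau> \<in> E"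
    show "\<tau> \<in> CS (n * l) \<union> (\<Union>i\<in>{1..t}. B i)"
    proof (cases "\<tau> \<in> (\<Union>i\<in>{1..t}. B i)")
      case False
      have \<tau>': "\<tau> \<in> G (n * l)" "restrict \<tau> (FL n) \<in> CS n" using \<tau> by (auto simp: E_def)
      have "restrict (restrict \<tau> (FL n)) F = restrict \<tau> F" using F_subset_FL by (auto simp: fun_eq_iff)
      then have "restrict \<tau> F \<in> C" using \<tau>'(2) by (simp add: C_set_def)
      moreover have "\<not> (\<forall>x\<in>K_field W k i p. \<tau> x = x)"
        if i: "i \<in> {1..t}" and p: "Factorial_Ring.prime p" "p dvd n * l" for i p
      proof (cases "p dvd n")
        case True
        then obtain x where "x \<in> K_field W k i p" "restrict \<tau> (FL n) x \<noteq> x"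
          using CS_nontrivial[OF \<tau>'(2) i p(1)] by blast
        moreover have "x \<in> FL n" using K_field_subset_FL[OF i p(1) True] \<open>x \<in> K_field W k i p\<close> by blast
        ultimately show ?thesis by auto
      next
        case False': False
        then have "p = l" using p l(1) by (metis prime_dvd_mult_iff primes_dvd_imp_eq)
        then show ?thesis using False i \<tau> by (auto simp: B_def)
      qed
      ultimately show ?thesis using \<tau>'(1) by (simp add: C_set_def)
    qed simp
  qed
  have B: "real (card (B i)) \<le> real (card E) * real (2 * fact f) / real (l * (l - 1))"
    if i: "i \<in> {1..t}" for i
  proof -
    obtain \<theta>' where "\<theta>' \<in> \<real>" "\<theta>' \<notin> \<rat>" "\<theta>' ^ l \<in> W i" using \<theta>[OF i] by blast
    from trivial_extensions_card[OF n0 l kl[OF i] fin' i orbit this]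
    have "card (B i) * (l * (l - 1)) \<le> card E * (2 * fact f)" by (simp add: B_def E_def)
    then have "real (card (B i) * (l * (l - 1))) \<le> real (card E * (2 * fact f))" by (simp only: of_nat_le_iff)
    moreover have "real (l * (l - 1)) > 0" using l1 by simp
    ultimately show ?thesis by (simp only: of_nat_mult pos_le_divide_eq)
  qed
  have "card E \<le> card (CS (n * l) \<union> (\<Union>i\<in>{1..t}. B i))"
    using finE CS_subset[of "n * l"] fin' by (intro card_mono sub) (auto simp: B_def intro: finite_subset)
  also have "\<dots> \<le> card (CS (n * l)) + (\<Sum>i\<in>{1..t}. card (B i))"
    by (rule order_trans[OF card_Un_le add_left_mono[OF card_UN_le]]) simp
  finally have "real (card E) \<le> real (card (CS (n * l))) + (\<Sum>i\<in>{1..t}. real (card (B i)))"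
    by (metis of_nat_add of_nat_le_iff of_nat_sum)
  also have "(\<Sum>i\<in>{1..t}. real (card (B i))) \<le> (\<Sum>i\<in>{1..t}. real (card E) * real (2 * fact f) / real (l * (l - 1)))"
    by (rule sum_mono) (rule B)
  also have "\<dots> = real (card E) * (real (t * (2 * fact f)) / real (l * (l - 1)))"
    by simp
  finally have "real (card E) * (1 - real (t * (2 * fact f)) / real (l * (l - 1))) \<le> real (card (CS (n * l)))"
    by (simp only: right_diff_distrib)  simp
  then have "real c * (real (card (CS n)) * (1 - real (t * (2 * fact f)) / real (l * (l - 1)))) \<le> real (card (CS (n * l)))"
    unfolding E by (simp only: of_nat_mult mult.assoc)
  then have "real c * (real (card (CS n)) * (1 - real (t * (2 * fact f)) / real (l * (l - 1)))) / (real c * real (card (G n)))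
     \<le> real (card (CS (n * l))) / (real c * real (card (G n)))"
    by (rule divide_right_mono) simp
  then show ?thesis unfolding dens_altdef Gm using c(1) by (simp only: of_nat_mult) simp
qed

end

section \<open>Positivity of the limit\<close>

text \<open>Take \<open>w\<close> in \<open>V\<close> other than 0, 1 and -1, of absolute value
  \<open>a / b\<close>. If its real \<open>l\<close>-th root were \<open>m / n\<close> up to sign in
  lowest terms, \<open>m ^ l\<close> would divide \<open>a\<close> and \<open>n ^ l\<close> would
  divide \<open>b\<close>. For \<open>l \<ge> a + b\<close> this leaves \<open>m = n = 1\<close>,
  against the choice of \<open>w\<close>. Oddness of \<open>l\<close> provides a real root for
  negative \<open>w\<close> too.\<close>

lemma irrational_real_radical:
  assumes V: "infinite V" "V \<subseteq> \<rat>"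
  obtains B :: nat where
    "\<And>l. odd l \<Longrightarrow> l \<ge> B \<Longrightarrow> \<exists>\<theta>::complex. \<theta> \<in> \<real> \<and> \<theta> \<notin> \<rat> \<and> \<theta> ^ l \<in> V"
proof -
  have "infinite (V - {0, 1, -1})" using V(1) by (simp add: infinite_remove)
  then have "V - {0, 1, -1} \<noteq> {}" by (metis finite.emptyI)
  then obtain w where w: "w \<in> V" "w \<noteq> 0" "w \<noteq> 1" "w \<noteq> -1" by blast
  obtain r where r: "r \<in> \<rat>" "w = complex_of_real r"
  proof -
    have "w \<in> \<rat>" using V(2) w(1) by blast
    then obtain a b where "w = of_int a / of_int b" by (auto elim: Rats_cases')
    then have "w = complex_of_real (of_int a / of_int b)" by simp
    then show ?thesis using that[of "of_int a / of_int b"] by simp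
  qed
  have r0: "r \<noteq> 0" "\<bar>r\<bar> \<noteq> 1" using w(2-4) r(2) by (auto simp: abs_if split: if_splits)
  obtain a b :: nat where ab: "b \<noteq> 0" "\<bar>r\<bar> = real a / real b"
    using Rats_abs_nat_div_natE[OF r(1)] by metis
  have a0: "a \<noteq> 0" using r0(1) ab(2) by (cases "a = 0") auto
  have "\<exists>\<theta>. \<theta> \<in> \<real> \<and> \<theta> \<notin> \<rat> \<and> \<theta> ^ l \<in> V" if l: "odd l" "l \<ge> a + b" for l
  proof (intro exI conjI)
    let ?\<theta> = "complex_of_real (root l r)"
    have rt: "root l r ^ l = r" using l(1) by (simp add: odd_real_root_pow)
    then show "?\<theta> ^ l \<in> V" using w(1) r(2) by (metis of_real_power)
    show "?\<theta> \<in> \<real>" by simp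
    show "?\<theta> \<notin> \<rat>"
    proof
      assume "?\<theta> \<in> \<rat>"
      then obtain u v where "?\<theta> = of_int u / of_int v" by (auto elim: Rats_cases')
      then have "?\<theta> = complex_of_real (of_int u / of_int v)" by simp
      then have "root l r \<in> \<rat>" unfolding of_real_eq_iff by simp
      then obtain m n :: nat where mn: "n \<noteq> 0" "\<bar>root l r\<bar> = real m / real n" "coprime m n"
        by (rule Rats_abs_nat_div_natE)
      have "real a / real b = (real m / real n) ^ l"
        using rt ab(2) mn(2) by (metis power_abs)
      then have "real a * real n ^ l = real m ^ l * real b"
        using ab(1) mn(1) by (simp add: power_divide field_simps)
      then have eq: "a * n ^ l = m ^ l * b" by (metis of_nat_eq_iff of_nat_mult of_nat_power)
      have cop: "coprime (m ^ l) (n ^ l)" using mn(3) by simp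
      have "m ^ l dvd a * n ^ l" using eq by simp
      then have ma: "m ^ l \<le> a" using cop a0 by (simp add: coprime_dvd_mult_left_iff dvd_imp_le)
      have "n ^ l dvd m ^ l * b" using eq by (metis dvd_triv_right)
      then have nb: "n ^ l \<le> b" using cop ab(1) by (simp add: coprime_dvd_mult_right_iff coprime_commute dvd_imp_le)
      have small: "c \<le> 1" if "c ^ l \<le> a + b" for c :: nat
      proof (rule ccontr)
        assume "\<not> c \<le> 1"
        then have "2 ^ l \<le> c ^ l" by (intro power_mono) auto
        moreover have "l < 2 ^ l" by (rule less_exp)
        ultimately show False using that l(2) by linarith
      qed
      have "m \<le> 1" "n \<le> 1" using small ma nb by auto
      moreover have "m \<noteq> 0"
      proof
        assume "m = 0"
        then have "root l r = 0" using mn(2) by simp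
        then have "0 ^ l = r" using rt by simp
        then show False using r0(1) l(1) by (cases l) auto
      qed
      ultimately have "m = 1" "n = 1" using mn(1) by auto
      then have "\<bar>root l r\<bar> = 1" using mn(2) by simp
      then have "\<bar>r\<bar> = 1" using rt by (metis power_abs power_one)
      then show False using r0 by simp
    qed
  qed
  then show ?thesis using that[of "a + b"] by blast
qed

text \<open>Over an interval of integers containing \<open>P\<close> the sum telescopes, each term
  being \<open>1 / (p - 1) - 1 / p\<close>.\<close>

lemma sum_inverse_pronic_le:
  fixes a :: nat
  assumes "finite P" "P \<subseteq> {a..}" "a \<ge> 2"
  shows "(\<Sum>p\<in>P. 1 / real (p * (p - 1))) \<le> 1 / real (a - 1)"
proof -
  have bound: "(\<Sum>p\<in>{a..<a + m}. 1 / real (p * (p - 1))) = 1 / real (a - 1) - 1 / real (a + m - 1)" for m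
  proof (induction m)
    case (Suc m)
    have *: "real (a + m - 1) = real a + real m - 1" "real (a + Suc m - 1) = real a + real m"
      using assms(3) by (auto simp: of_nat_diff)
    have "1 / (x * (x - 1)) = 1 / (x - 1) - 1 / x" if "x > 1" for x :: real
      using that by (simp add: field_simps)
    from this[of "real a + real m"] show ?case
      using Suc * assms(3) by simp
  qed simp
  obtain M where M: "P \<subseteq> {..<M}" using assms(1) finite_nat_iff_bounded by blast
  have "P \<subseteq> {a..<a + M}"
  proof
    fix p assume "p \<in> P"
    then have "p \<in> {..<M}" "p \<in> {a..}" using M assms(2) by blast+
    then show "p \<in> {a..<a + M}" by simp
  qed
  then have "(\<Sum>p\<in>P. 1 / real (p * (p - 1))) \<le> (\<Sum>p\<in>{a..<a + M}. 1 / real (p * (p - 1)))"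
    by (intro sum_mono2) auto
  also have "\<dots> \<le> 1 / real (a - 1)" unfolding bound by simp
  finally show ?thesis .
qed

section \<open>Limits along squarefree integers ordered by divisibility\<close>

lemma squarefree_prod_primes:
  assumes "\<And>p::nat. p \<in> Q \<Longrightarrow> Factorial_Ring.prime p"
  shows "squarefree (\<Prod>Q)"
  using assms by (intro squarefree_prod_coprime squarefree_prime primes_coprime) auto

lemma squarefree_dvd_prod_primes:
  assumes m: "squarefree (m::nat)" and Q: "finite Q" "prime_factors m \<subseteq> Q"
  shows "m dvd \<Prod>Q"
proof -
  have m0: "m \<noteq> 0" using m by (metis not_squarefree_0)
  have "m = (\<Prod>p\<in>prime_factors m. p ^ multiplicity p m)" using prime_factorization_nat m0 by simp
  also have "\<dots> = \<Prod>(prime_factors m)"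
    using m m0 by (intro prod.cong) (auto simp: squarefree_factorial_semiring')
  also have "\<dots> dvd \<Prod>Q" by (rule prod_dvd_prod_subset[OF Q])
  finally show ?thesis .
qed

text \<open>The product of all primes dividing \<open>a\<close> or \<open>b\<close> is a squarefree
  common multiple, so the sets of squarefree multiples form a filter base.\<close>

lemma eventually_at_squarefree:
  "eventually P at_squarefree \<longleftrightarrow> (\<exists>n. squarefree n \<and> (\<forall>m. squarefree m \<longrightarrow> n dvd m \<longrightarrow> P m))"
  unfolding at_squarefree_def
proof (subst eventually_INF_base)
  show "{n::nat. squarefree n} \<noteq> {}" using squarefree_1 by blast
  fix a b :: nat assume "a \<in> {n. squarefree n}" "b \<in> {n. squarefree n}"
  define x where "x = \<Prod>(prime_factors a \<union> prime_factors b)"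
  have "squarefree x" "a dvd x" "b dvd x"
    using \<open>a \<in> _\<close> \<open>b \<in> _\<close> unfolding x_def
    by (auto intro!: squarefree_prod_primes squarefree_dvd_prod_primes)
  then show "\<exists>x\<in>{n. squarefree n}. principal {m. squarefree m \<and> x dvd m}
     \<le> inf (principal {m. squarefree m \<and> a dvd m}) (principal {m. squarefree m \<and> b dvd m})"
    by (intro bexI[of _ x]) (auto intro: dvd_trans)
qed (auto simp: eventually_principal)

text \<open>A decreasing net that is bounded below converges to its infimum.\<close>

lemma Lim_at_squarefree_antimono:
  fixes d :: "nat \<Rightarrow> real"
  assumes mono: "\<And>m n. squarefree m \<Longrightarrow> n dvd m \<Longrightarrow> d m \<le> d n"
    and lower: "\<And>m. squarefree m \<Longrightarrow> \<delta> \<le> d m"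
  shows "\<delta> \<le> Lim at_squarefree d"
proof -
  let ?S = "{n::nat. squarefree n}"
  define L where "L = Inf (d ` ?S)"
  have bdd: "bdd_below (d ` ?S)" using lower by (intro bdd_belowI[of _ \<delta>]) auto
  have ne: "d ` ?S \<noteq> {}" using squarefree_1 by blast
  have L: "L \<le> d m" if "squarefree m" for m unfolding L_def using bdd that by (intro cInf_lower) auto
  \<comment> \<open>Nontriviality of the filter makes the limit unique, which identifies
    \<open>Lim\<close> with the infimum.\<close>
  have "at_squarefree \<noteq> bot"
    unfolding trivial_limit_def eventually_at_squarefree by auto
  moreover have "(d \<longlongrightarrow> L) at_squarefree"
  proof (rule order_tendstoI)
    fix a assume "a < L"
    then show "eventually (\<lambda>n. a < d n) at_squarefree"
      unfolding eventually_at_squarefree using L by (intro exI[of _ 1]) (auto intro: less_le_trans)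
  next
    fix a assume "L < a"
    then obtain n where "squarefree n" "d n < a" unfolding L_def using cInf_lessD[OF ne] by auto
    then show "eventually (\<lambda>n. d n < a) at_squarefree"
      unfolding eventually_at_squarefree using mono by (intro exI[of _ n]) (auto intro: le_less_trans)
  qed
  ultimately have "Lim at_squarefree d = L" by (rule tendsto_Lim)
  moreover have "\<delta> \<le> L" unfolding L_def using ne lower by (intro cInf_greatest) auto
  ultimately show ?thesis by simp
qed

lemma QQ_adjoin_subfield_eq:
  assumes "subfield F CC" shows "QQ_adjoin F = F"
proof (intro equalityI subsetI)
  fix x assume "x \<in> QQ_adjoin F"
  then show "x \<in> F"
  proof (induction rule: QQ_adjoin_induct)
    case (rat q) then show ?case using Rats_subset_subfield[OF assms] by blast
  next
    case (inverse x)
    then show ?case using ring.subfield_m_inv(1)[OF ring_CC assms, of x] by (cases "x = 0") auto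
  qed (use subringE(5-7)[OF subfieldE(1)[OF assms]] in auto)
qed (rule QQ_adjoin_incl)

text \<open>No prime divides 1, so \<open>L_field\<close> contributes nothing at level 1; facts
  about level 1 become facts about \<open>F\<close>.\<close>

lemma FL_field_1:
  assumes "subfield F CC" shows "FL_field t W k F 1 = F"
proof -
  have no: "{l::nat. Factorial_Ring.prime l \<and> l dvd 1} = {}" by auto
  have sub: "L_field t W k 1 \<subseteq> QQ_adjoin F"
    unfolding L_field_def no by (rule QQ_adjoin_mono) auto
  have "FL_field t W k F 1 \<subseteq> QQ_adjoin F"
    unfolding FL_field_def using sub by (intro QQ_adjoin_mono) (auto intro: QQ_adjoin_incl)
  moreover have "F \<subseteq> FL_field t W k F 1" by (auto simp: FL_field_def intro: QQ_adjoin_incl)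
  ultimately show ?thesis using QQ_adjoin_subfield_eq[OF assms] by auto
qed

theorem theorem4p2:
  fixes t :: nat
    and W :: "nat \<Rightarrow> complex set"
    and k :: "nat \<Rightarrow> nat"
    and F :: "complex set"
    and C :: "(complex \<Rightarrow> complex) set"
  assumes "\<And>i. i \<in> {1..t} \<Longrightarrow> finitely_generated_subgroup QQ_units (W i)"
    and "\<And>i. i \<in> {1..t} \<Longrightarrow> infinite (W i)"
    and "\<And>i. i \<in> {1..t} \<Longrightarrow> k i > 0"
    and "finite_galois_extension F \<rat>"
    and "conjugacy_class (galois_group F \<rat>) C"
    and "\<And>n. squarefree n \<Longrightarrow> dens t W k F C n \<noteq> 0"
  shows "dens_infinity t W k F C \<noteq> 0"
proof -
  let ?d = "dens t W k F C"
  have W: "W i \<subseteq> \<rat>" if "i \<in> {1..t}" for i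
    using assms(1)[OF that] subgroup.subset[of "W i" QQ_units]
    by (auto simp: finitely_generated_subgroup_def)
  have F: "subfield F CC" and fixed: "{x \<in> F. \<forall>\<sigma>\<in>carrier (galois_group F \<rat>). \<sigma> x = x} = \<rat>"
    using assms(4) by (simp_all add: finite_galois_extension_def)
  \<comment> \<open>If the group were infinite, its order would count as 0 and the quotient would be
    0 as well, so a nonzero density forces finiteness.\<close>
  have fin: "finite (carrier (galois_group (FL_field t W k F n) \<rat>))" if "squarefree n" for n
    using assms(6)[OF that] by (auto simp: dens_def Coset.order_def intro: card_ge_0_finite)
  have finF: "finite (carrier (galois_group F \<rat>))"
    using fin[OF squarefree_1] unfolding FL_field_1[OF F] .
  have stF: "stable F" by (rule stable_galois[OF F fixed finF])
  interpret tower t W k F C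
    using W assms(3) stF fin by unfold_locales auto
  define f where "f = card (carrier (galois_group F \<rat>))"
  \<comment> \<open>Automorphisms act on \<open>F\<close> through its Galois group, whose order
    therefore bounds the orbits.\<close>
  have orbit: "finite ((\<lambda>g. g x) ` Aut_Qbar) \<and> card ((\<lambda>g. g x) ` Aut_Qbar) \<le> f" if x: "x \<in> F" for x
  proof -
    have "(\<lambda>g. g x) ` Aut_Qbar = (\<lambda>\<sigma>. \<sigma> x) ` carrier (galois_group F \<rat>)"
      unfolding carrier_galois_group_stable[OF stF] image_image using x by simp
    then show ?thesis using finF by (simp add: f_def card_image_le)
  qed
  have "\<exists>B. \<forall>l. odd l \<longrightarrow> l \<ge> B \<longrightarrow> (\<exists>\<theta>::complex. \<theta> \<in> \<real> \<and> \<theta> \<notin> \<rat> \<and> \<theta> ^ l \<in> W i)"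
    if "i \<in> {1..t}" for i
    by (rule irrational_real_radical[OF assms(2)[OF that] W[OF that]]) blast
  then obtain B :: "nat \<Rightarrow> nat" where B: "\<And>i l. i \<in> {1..t} \<Longrightarrow> odd l \<Longrightarrow> l \<ge> B i \<Longrightarrow>
      \<exists>\<theta>::complex. \<theta> \<in> \<real> \<and> \<theta> \<notin> \<rat> \<and> \<theta> ^ l \<in> W i" by metis
  define c where "c = t * (2 * fact f)"
  \<comment> \<open>The summands ensure, for primes \<open>l \<ge> a\<close>:
    \<open>l \<noteq> 2\<close> and \<open>l > f\<close>, irrational real \<open>l\<close>-th roots
    for each \<open>W i\<close>, \<open>l\<close> not dividing \<open>k i\<close>, and a total loss
    of at most one half over all large primes.\<close>
  define a where "a = 3 + f + (\<Sum>i\<in>{1..t}. B i) + (\<Sum>i\<in>{1..t}. k i) + 2 * c"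
  have Ba: "B i \<le> a" if "i \<in> {1..t}" for i
    using member_le_sum[of i "{1..t}" B] that by (simp add: a_def)
  have ka: "k i < a" if "i \<in> {1..t}" for i
    using member_le_sum[of i "{1..t}" k] that by (simp add: a_def)
  have step: "?d n * (1 - real c / real (l * (l - 1))) \<le> ?d (n * l)"
    if "squarefree (n * l)" and l: "Factorial_Ring.prime l" "\<not> l dvd n" "l \<ge> a" for n l
    unfolding c_def
  proof (rule dens_step[where f = f, OF that(1) l(1,2) _ _ _ orbit])
    show "l \<noteq> 2" "l > f" using l(3) by (auto simp: a_def)
    have "odd l" using l(1) \<open>l \<noteq> 2\<close> prime_odd_nat prime_ge_2_nat[OF l(1)] by auto
    show "\<exists>\<theta>. \<theta> \<in> \<real> \<and> \<theta> \<notin> \<rat> \<and> \<theta> ^ l \<in> W i" if "i \<in> {1..t}" for i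
      using B[OF that \<open>odd l\<close>] Ba[OF that] l(3) by simp
    show "\<not> l dvd k i" if i: "i \<in> {1..t}" for i
      using ka[OF i] l(3) assms(3)[OF i] dvd_imp_le[of l "k i"] by auto
  qed
  \<comment> \<open>All small primes go into the initial modulus, where positivity of the density is
    the hypothesis; only large primes are then added.\<close>
  define Q where "Q = {p. Factorial_Ring.prime p \<and> p < a}"
  have finQ: "finite Q" by (simp add: Q_def)
  define \<delta> where "\<delta> = ?d (\<Prod>Q)"
  have sqQ: "squarefree (\<Prod>Q)" by (rule squarefree_prod_primes) (simp add: Q_def)
  have "\<delta> > 0" unfolding \<delta>_def using assms(6)[OF sqQ] dens_nonneg[of "\<Prod>Q"] by simp
  \<comment> \<open>The product of the factors from \<open>step\<close> is bounded below by one
    minus the sum of the losses, using \<open>(1 - s) * (1 - x) \<ge> 1 - (x + s)\<close>; no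
    infinite product is needed.\<close>
  have large: "\<delta> * (1 - (\<Sum>p\<in>P. real c / real (p * (p - 1)))) \<le> ?d (\<Prod>(Q \<union> P))"
    if "finite P" "P \<subseteq> {p. Factorial_Ring.prime p \<and> p \<ge> a}" for P
    using that
  proof (induction P rule: finite_induct)
    case (insert l P)
    let ?x = "real c / real (l * (l - 1))" and ?s = "\<Sum>p\<in>P. real c / real (p * (p - 1))"
    have l: "Factorial_Ring.prime l" "l \<ge> a" using insert.prems by auto
    have lnot: "l \<notin> Q \<union> P" using insert.hyps l by (auto simp: Q_def)
    have primes: "Factorial_Ring.prime p" if "p \<in> Q \<union> insert l P" for p
      using that insert.prems by (auto simp: Q_def)
    have eq: "\<Prod>(Q \<union> insert l P) = \<Prod>(Q \<union> P) * l"
      using lnot insert.hyps finQ by simp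
    have "squarefree (\<Prod>(Q \<union> insert l P))" by (rule squarefree_prod_primes[OF primes])
    then have sq: "squarefree (\<Prod>(Q \<union> P) * l)" unfolding eq .
    have "\<not> l dvd \<Prod>(Q \<union> P)"
    proof
      assume "l dvd \<Prod>(Q \<union> P)"
      then obtain p where "p \<in> Q \<union> P" "l dvd p"
        using prime_dvd_prod_iff[of "Q \<union> P" l "\<lambda>p. p"] finQ insert.hyps l(1) by auto
      then show False using primes_dvd_imp_eq[OF l(1), of p] primes[of p] lnot by auto
    qed
    from step[OF sq l(1) this l(2)]
    have st: "?d (\<Prod>(Q \<union> P)) * (1 - ?x) \<le> ?d (\<Prod>(Q \<union> insert l P))" unfolding eq .
    \<comment> \<open>This keeps the factor \<open>1 - ?x\<close> nonnegative, so that the induction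
      hypothesis may be multiplied by it.\<close>
    have "c \<le> l * (l - 1)"
    proof -
      have "c \<le> l" "l - 1 \<ge> 1" using l(2) by (auto simp: a_def)
      then show ?thesis using mult_le_mono[of c l 1 "l - 1"] by simp
    qed
    then have "real c \<le> real (l * (l - 1))" by (simp only: of_nat_le_iff)
    moreover have "real (l * (l - 1)) > 0" using l(2) by (simp add: a_def)
    ultimately have x: "0 \<le> ?x" "?x \<le> 1" by (simp_all only: divide_le_eq_1_pos zero_le_divide_iff of_nat_0_le_iff) simp
    have s: "0 \<le> ?s" by (intro sum_nonneg) simp
    have "\<delta> * (1 - (?x + ?s)) \<le> \<delta> * (1 - ?s) * (1 - ?x)"
    proof -
      have "1 - (?x + ?s) \<le> (1 - ?s) * (1 - ?x)" using mult_nonneg_nonneg[OF x(1) s] by (simp only: algebra_simps) simp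
      then show ?thesis using \<open>\<delta> > 0\<close> by (simp only: mult.assoc mult_le_cancel_left_pos)
    qed
    also have "\<dots> \<le> ?d (\<Prod>(Q \<union> P)) * (1 - ?x)"
      using insert.IH insert.prems x(2) by (intro mult_right_mono) auto
    finally show ?case using st unfolding sum.insert[OF insert.hyps] by linarith
  qed (simp add: \<delta>_def)
  \<comment> \<open>\<open>m\<close> divides the product of \<open>Q\<close> and its own large
    primes, so by monotonicity the bound at that product suffices; the losses sum to at most
    \<open>c / (a - 1) \<le> 1 / 2\<close>.\<close>
  have "\<delta> / 2 \<le> ?d m" if m: "squarefree m" for m
  proof -
    define P where "P = {p \<in> prime_factors m. p \<ge> a}"
    have P: "finite P" "P \<subseteq> {p. Factorial_Ring.prime p \<and> p \<ge> a}" by (auto simp: P_def)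
    have "(\<Sum>p\<in>P. real c / real (p * (p - 1))) = real c * (\<Sum>p\<in>P. 1 / real (p * (p - 1)))"
      unfolding sum_distrib_left by simp
    also have "\<dots> \<le> real c * (1 / real (a - 1))"
      using P by (intro mult_left_mono sum_inverse_pronic_le) (auto simp: a_def)
    also have "\<dots> \<le> 1 / 2"
    proof -
      have "2 * c \<le> a - 1" "a - 1 > 0" by (auto simp: a_def)
      then have "2 * real c \<le> real (a - 1)" "real (a - 1) > 0" by linarith+
      then show ?thesis by (simp add: field_simps)
    qed
    finally have "\<delta> * (1 / 2) \<le> \<delta> * (1 - (\<Sum>p\<in>P. real c / real (p * (p - 1))))"
      using \<open>\<delta> > 0\<close> by (intro mult_left_mono) auto
    also have "\<dots> \<le> ?d (\<Prod>(Q \<union> P))" by (rule large[OF P])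
    also have "\<dots> \<le> ?d m"
    proof (rule dens_antimono)
      show "squarefree (\<Prod>(Q \<union> P))" using P(2) by (intro squarefree_prod_primes) (auto simp: Q_def)
      show "m dvd \<Prod>(Q \<union> P)" using finQ P(1)
        by (intro squarefree_dvd_prod_primes[OF m]) (auto simp: Q_def P_def not_less)
    qed
    finally show ?thesis by simp
  qed
  then have "\<delta> / 2 \<le> dens_infinity t W k F C"
    unfolding dens_infinity_def using dens_antimono by (intro Lim_at_squarefree_antimono) auto
  then show ?thesis using \<open>\<delta> > 0\<close> by linarith
qed

end
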